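(* Let $G=(V,E)$ be a vertex and edge transitive graph on $n$ vertices and let $t\in[0,1]$ be irrational. Suppose that the value of $f_q(t)$ is attained in the infimum defining it, i.e. there is $p\in\Gamma_q(t)$ with $F(p)=f_q(t)$. Then there is a nondegenerate interval $[r,s]$ having rational endpoints such that $t\in[r,s]$ and the restriction of $f_q$ to $[r,s]$ is linear (that is, of the form $x\mapsto ax+b$).
   Context: Graphs are finite, simple and nonempty, with vertex set $V=\{1,\dots,n\}$ and edge set $E\subseteq V\times V$ a symmetric irreflexive relation; each edge appears twice in $E$, as $(v,w)$ and $(w,v)$. A graph automorphism is a bijection $\pi:V\to V$ with $(v,w)\in E$ if and only if $(\pi(v),\pi(w))\in E$. $G$ is vertex transitive if for all $v,w\in V$ there is an automorphism $\pi$ with $\pi(v)=w$; $G$ is edge transitive if for all $(v,w),(x,y)\in E$ there is an automorphism $\pi$ with $(\pi(v),\pi(w))=(x,y)$. A PVM on a Hilbert space is a finite family of projections summing to the identity. $C_q(n,2)\subseteq\mathbb R^{4n^2}$ is the set of tuples $(p(i,j|v,w))$, $1\le v,w\le n$, $i,j\in\{0,1\}$, for which there exist finite dimensional Hilbert spaces $\mathcal H_A,\mathcal H_B$, PVMs $\{P_{v,i}\}_{i}$ on $\mathcal H_A$ and $\{Q_{w,j}\}_{j}$ on $\mathcal H_B$ for $1\le v,w\le n$, and a unit vector $h\in\mathcal H_A\otimes\mathcal H_B$ with $p(i,j|v,w)=\langle(P_{v,i}\otimes Q_{w,j})h,h\rangle$. A tuple is synchronous if $p(i,j|v,v)=0$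 for all $v$ and all $i\neq j$; $C_q^s(n,2)$ is the set of synchronous elements of $C_q(n,2)$. The marginals are $p_A(i|v)=\sum_j p(i,j|v,w)$ (independent of $w$) and $p_B(j|w)=\sum_i p(i,j|v,w)$ (independent of $v$). For $t\in[0,1]$, $\Gamma_q(t)=\{p\in C_q^s(n,2): p_A(0|v)=p_B(0|w)=t \text{ for all } v,w\in V\}$. Put $F(p)=\sum_{(v,w)\in E}p(0,0|v,w)$ and $f_q(t)=\inf\{F(p):p\in\Gamma_q(t)\}$. *)

theory Defs
  imports
    Complex_Main
    "HOL-Library.FuncSet"
    "Jordan_Normal_Form.Schur_Decomposition"
begin

subsection \<open>Graphs\<close>

definition simple_graph :: "nat \<Rightarrow> (nat \<times> nat) set \<Rightarrow> bool" where
  "simple_graph n E \<longleftrightarrow> n \<ge> 1 \<and> E \<subseteq> {1..n} \<times> {1..n} \<and> sym E \<and> irrefl E"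

definition graph_automorphism :: "nat \<Rightarrow> (nat \<times> nat) set \<Rightarrow> (nat \<Rightarrow> nat) \<Rightarrow> bool" where
  "graph_automorphism n E \<pi> \<longleftrightarrow>
     bij_betw \<pi> {1..n} {1..n} \<and>
     (\<forall>v\<in>{1..n}. \<forall>w\<in>{1..n}. (v, w) \<in> E \<longleftrightarrow> (\<pi> v, \<pi> w) \<in> E)"

definition vertex_transitive :: "nat \<Rightarrow> (nat \<times> nat) set \<Rightarrow> bool" where
  "vertex_transitive n E \<longleftrightarrow>
     (\<forall>v\<in>{1..n}. \<forall>w\<in>{1..n}. \<exists>\<pi>. graph_automorphism n E \<pi> \<and> \<pi> v = w)"

definition edge_transitive :: "nat \<Rightarrow> (nat \<times> nat) set \<Rightarrow> bool" where
  "edge_transitive n E \<longleftrightarrow>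
     (\<forall>(v, w)\<in>E. \<forall>(x, y)\<in>E. \<exists>\<pi>. graph_automorphism n E \<pi> \<and> (\<pi> v, \<pi> w) = (x, y))"

subsection \<open>Quantum correlations\<close>

text \<open>A finite dimensional Hilbert space is taken to be the space of complex column vectors of
  some dimension \<open>d\<close>, and its operators to be the \<open>d \<times> d\<close> matrices.  The tensor product of the
  spaces of dimensions \<open>a\<close> and \<open>b\<close> is the space of dimension \<open>a * b\<close>, where the product of the
  basis vectors with indices \<open>i < a\<close> and \<open>k < b\<close> has index \<open>i * b + k\<close>.\<close>

definition projection :: "nat \<Rightarrow> complex mat \<Rightarrow> bool" where
  "projection d P \<longleftrightarrow> P \<in> carrier_mat d d \<and> P * P = P \<and> mat_adjoint P = P"

definition two_outcome_pvm :: "nat \<Rightarrow> (nat \<Rightarrow> complex mat) \<Rightarrow> bool" where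
  "two_outcome_pvm d P \<longleftrightarrow> projection d (P 0) \<and> projection d (P 1) \<and> P 0 + P 1 = 1\<^sub>m d"

definition tensor_mat :: "complex mat \<Rightarrow> complex mat \<Rightarrow> complex mat" where
  "tensor_mat A B = mat (dim_row A * dim_row B) (dim_col A * dim_col B)
     (\<lambda>(i, j). A $$ (i div dim_row B, j div dim_col B) * B $$ (i mod dim_row B, j mod dim_col B))"

text \<open>The entry \<open>p(i,j|v,w)\<close> of a tuple is \<open>p (i, j, v, w)\<close>.  Tuples are extensional functions on
  the index set, so that they correspond one-to-one to the points of the real space of
  dimension \<open>4 * n\<^sup>2\<close>.\<close>

type_synonym tuple = "nat \<times> nat \<times> nat \<times> nat \<Rightarrow> real"

definition indices :: "nat \<Rightarrow> (nat \<times> nat \<times> nat \<times> nat) set" where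
  "indices n = {0, 1} \<times> {0, 1} \<times> {1..n} \<times> {1..n}"

definition C_q :: "nat \<Rightarrow> tuple set" where
  "C_q n = {p \<in> extensional (indices n).
     \<exists>a b P Q h.
       (\<forall>v\<in>{1..n}. two_outcome_pvm a (P v)) \<and>
       (\<forall>w\<in>{1..n}. two_outcome_pvm b (Q w)) \<and>
       h \<in> carrier_vec (a * b) \<and> h \<bullet>c h = 1 \<and>
       (\<forall>(i, j, v, w)\<in>indices n.
          complex_of_real (p (i, j, v, w)) = (tensor_mat (P v i) (Q w j) *\<^sub>v h) \<bullet>c h)}"

definition synchronous :: "nat \<Rightarrow> tuple \<Rightarrow> bool" where
  "synchronous n p \<longleftrightarrow>
     (\<forall>v\<in>{1..n}. \<forall>i\<in>{0, 1}. \<forall>j\<in>{0, 1}. i \<noteq> j \<longrightarrow> p (i, j, v, v) = 0)"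

definition C_q_s :: "nat \<Rightarrow> tuple set" where
  "C_q_s n = {p \<in> C_q n. synchronous n p}"

text \<open>For tuples in \<open>C_q n\<close> the marginal \<open>marginal_A p i v w\<close> does not depend on \<open>w\<close>, and
  \<open>marginal_B p j v w\<close> does not depend on \<open>v\<close>; the arguments are kept to avoid a choice.\<close>

definition marginal_A :: "tuple \<Rightarrow> nat \<Rightarrow> nat \<Rightarrow> nat \<Rightarrow> real" where
  "marginal_A p i v w = (\<Sum>j\<in>{0, 1}. p (i, j, v, w))"

definition marginal_B :: "tuple \<Rightarrow> nat \<Rightarrow> nat \<Rightarrow> nat \<Rightarrow> real" where
  "marginal_B p j v w = (\<Sum>i\<in>{0, 1}. p (i, j, v, w))"

definition Gamma_q :: "nat \<Rightarrow> real \<Rightarrow> tuple set" where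
  "Gamma_q n t = {p \<in> C_q_s n.
     \<forall>v\<in>{1..n}. \<forall>w\<in>{1..n}. marginal_A p 0 v w = t \<and> marginal_B p 0 v w = t}"

definition edge_sum :: "(nat \<times> nat) set \<Rightarrow> tuple \<Rightarrow> real" where
  "edge_sum E p = (\<Sum>(v, w)\<in>E. p (0, 0, v, w))"

text \<open>For \<open>t\<close> between 0 and 1 the infimum is taken over a nonempty set that is bounded below by 0.\<close>

definition f_q :: "nat \<Rightarrow> (nat \<times> nat) set \<Rightarrow> real \<Rightarrow> real" where
  "f_q n E t = Inf (edge_sum E ` Gamma_q n t)"

end

theory Submission
  imports Defs
begin

text \<open>A synchronous quantum correlation comes from a density matrix \<open>\<rho>\<close> that commutes with the
  projections \<open>P v\<close>, through \<open>p(0,0|v,w) = Tr (P v * P w * \<rho>)\<close>.  The eigenspaces of \<open>\<rho>\<close> write it as a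
  convex combination of normalised traces, whose marginals are quotients of ranks and hence
  rational.  Averaging over the automorphism group makes the marginals constant without changing
  \<open>F\<close>.  A minimiser at an irrational \<open>t\<close> is therefore a mixture of correlations with rational
  marginals on both sides of \<open>t\<close>, and equality in the convexity inequality forces \<open>f_q\<close> to coincide
  with a supporting line at all of them.\<close>

subsection \<open>Adjoints, traces and unitary diagonalisation\<close>

text \<open>Attainment matters because the decomposition concerns one correlation with a finite
  dimensional realisation: its density matrix has finite dimensional eigenspaces, which is why the
  pieces have rational marginals. An infimum that is only approached supplies no equality to
  exploit. With pieces of weight \<open>u k\<close>, mean marginal \<open>r k\<close> and edge sum
  \<open>F k\<close>, a supporting line L at t gives f(t) = sum u F \<ge> sum u f(r) \<ge> sum u
  L(r) = L(t) = f(t), and positive weights turn this into equality for each piece. Irrationality of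
  t rules out a piece with \<open>r k = t\<close>, which would say nothing about the slope. Working
  in an eigenbasis of the density matrix keeps the linear algebra elementary: commuting with it
  means vanishing entries between different weights, its square root is taken entrywise, its
  eigenspaces are level sets of the weights, and mixtures are block sums. Since there are two
  outcomes and the tuple is synchronous, the entries p(0,0|v,w) determine all others, so only a
  function \<open>c v w\<close> is carried along.\<close>

lemma mat_adjoint_dim [simp]:
  "dim_row (mat_adjoint A) = dim_col A" "dim_col (mat_adjoint A) = dim_row A"
  by (auto simp: mat_adjoint_def)

lemma mat_adjoint_carrier [simp]:
  "A \<in> carrier_mat n m \<Longrightarrow> mat_adjoint A \<in> carrier_mat m n"
  by (intro carrier_matI) auto

lemma mat_adjoint_index [simp]:
  "i < dim_col A \<Longrightarrow> j < dim_row A \<Longrightarrow> mat_adjoint A $$ (i, j) = conjugate (A $$ (j, i))"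
  by (simp add: mat_adjoint_def mat_of_rows_index)

lemma mat_adjoint_adjoint [simp]: "mat_adjoint (mat_adjoint A) = A"
  by (rule eq_matI) auto

lemma mat_mult_index:
  "A \<in> carrier_mat n m \<Longrightarrow> B \<in> carrier_mat m k \<Longrightarrow> i < n \<Longrightarrow> j < k \<Longrightarrow>
   (A * B) $$ (i, j) = (\<Sum>l<m. A $$ (i, l) * B $$ (l, j))"
  by (auto simp: scalar_prod_def atLeast0LessThan)

lemma square_mult_carrier [simp]:
  "A \<in> carrier_mat n n \<Longrightarrow> B \<in> carrier_mat n n \<Longrightarrow> A * B \<in> carrier_mat n n"
  by (rule mult_carrier_mat)

lemma mat_adjoint_mult:
  assumes "(A :: complex mat) \<in> carrier_mat n m" "B \<in> carrier_mat m k"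
  shows "mat_adjoint (A * B) = mat_adjoint B * mat_adjoint A"
proof (rule eq_matI)
  fix i j assume "i < dim_row (mat_adjoint B * mat_adjoint A)" "j < dim_col (mat_adjoint B * mat_adjoint A)"
  with assms have ij: "i < k" "j < n" by auto
  show "mat_adjoint (A * B) $$ (i, j) = (mat_adjoint B * mat_adjoint A) $$ (i, j)"
    using assms ij
    by (subst mat_mult_index[OF mat_adjoint_carrier[OF assms(2)] mat_adjoint_carrier[OF assms(1)]])
       (auto simp: scalar_prod_def atLeast0LessThan mult.commute intro!: sum.cong)
qed (use assms in auto)

lemma mat_adjoint_four_block:
  assumes "(A :: complex mat) \<in> carrier_mat n n" "D \<in> carrier_mat m m"
  shows "mat_adjoint (four_block_mat A (0\<^sub>m n m) (0\<^sub>m m n) D)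
    = four_block_mat (mat_adjoint A) (0\<^sub>m n m) (0\<^sub>m m n) (mat_adjoint D)"
  by (rule eq_matI) (use assms in auto)

lemma mult_four_block_diag:
  assumes "(A :: complex mat) \<in> carrier_mat n n" "D \<in> carrier_mat m m"
    "A' \<in> carrier_mat n n" "D' \<in> carrier_mat m m"
  shows "four_block_mat A (0\<^sub>m n m) (0\<^sub>m m n) D * four_block_mat A' (0\<^sub>m n m) (0\<^sub>m m n) D'
    = four_block_mat (A * A') (0\<^sub>m n m) (0\<^sub>m m n) (D * D')"
  using assms by (subst mult_four_block_mat) auto

section \<open>The trace and the Hilbert-Schmidt norm\<close>

definition mtrace :: "complex mat \<Rightarrow> complex" where
  "mtrace A = (\<Sum>i<dim_row A. A $$ (i, i))"

lemma mtrace_comm: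
  assumes "A \<in> carrier_mat n m" "B \<in> carrier_mat m n"
  shows "mtrace (A * B) = mtrace (B * A)"
proof -
  have "mtrace (A * B) = (\<Sum>i<n. \<Sum>l<m. A $$ (i, l) * B $$ (l, i))"
    unfolding mtrace_def using assms mat_mult_index[OF assms] by simp
  also have "\<dots> = (\<Sum>l<m. \<Sum>i<n. B $$ (l, i) * A $$ (i, l))"
    by (subst sum.swap) (simp add: mult.commute)
  also have "\<dots> = mtrace (B * A)"
    unfolding mtrace_def using assms mat_mult_index[OF assms(2,1)] by simp
  finally show ?thesis .
qed

lemma mtrace_add:
  "A \<in> carrier_mat n n \<Longrightarrow> B \<in> carrier_mat n n \<Longrightarrow> mtrace (A + B) = mtrace A + mtrace B"
  by (simp add: mtrace_def sum.distrib)

lemma mtrace_mult_adjoint: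
  assumes "A \<in> carrier_mat n m"
  shows "mtrace (A * mat_adjoint A) = of_real (\<Sum>i<n. \<Sum>j<m. (cmod (A $$ (i, j)))\<^sup>2)"
proof -
  have "mtrace (A * mat_adjoint A) = (\<Sum>i<n. \<Sum>l<m. A $$ (i, l) * mat_adjoint A $$ (l, i))"
    unfolding mtrace_def using assms mat_mult_index[OF assms, of "mat_adjoint A" n] by simp
  also have "\<dots> = (\<Sum>i<n. \<Sum>l<m. of_real ((cmod (A $$ (i, l)))\<^sup>2))"
    using assms by (auto intro!: sum.cong simp: complex_norm_square simp del: of_real_power)
  finally show ?thesis by simp
qed

text \<open>The trace is the squared Hilbert-Schmidt norm of \<open>A\<close>. This is how a
  vanishing probability becomes a matrix identity.\<close>

lemma mtrace_mult_adjoint_eq_0: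
  assumes "A \<in> carrier_mat n m" "mtrace (A * mat_adjoint A) = 0"
  shows "A = 0\<^sub>m n m"
proof (rule eq_matI)
  fix i j assume "i < dim_row (0\<^sub>m n m)" "j < dim_col (0\<^sub>m n m)"
  hence ij: "i < n" "j < m" by auto
  have "(\<Sum>i<n. \<Sum>j<m. (cmod (A $$ (i, j)))\<^sup>2) = 0"
    using assms mtrace_mult_adjoint by (metis of_real_eq_0_iff)
  hence "\<forall>i\<in>{..<n}. (\<Sum>j<m. (cmod (A $$ (i, j)))\<^sup>2) = 0"
    by (subst (asm) sum_nonneg_eq_0_iff) (auto intro: sum_nonneg)
  hence "(\<Sum>j<m. (cmod (A $$ (i, j)))\<^sup>2) = 0" using ij by auto
  hence "\<forall>j\<in>{..<m}. (cmod (A $$ (i, j)))\<^sup>2 = 0"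
    by (subst (asm) sum_nonneg_eq_0_iff) auto
  thus "A $$ (i, j) = 0\<^sub>m n m $$ (i, j)" using ij by auto
qed (use assms in auto)

text \<open>Gram-Schmidt, applied to a basis that begins with \<open>v\<close>, leaves
  \<open>v\<close> in front and yields orthogonal nonzero vectors; dividing each by its norm gives
  the columns of \<open>W\<close>. The first column is only claimed to be a multiple of
  \<open>v\<close>, as \<open>v\<close> need not be a unit vector.\<close>

lemma exists_unitary_first_column:
  assumes v: "(v :: complex vec) \<in> carrier_vec n" and v0: "v \<noteq> 0\<^sub>v n"
  shows "\<exists>W k. W \<in> carrier_mat n n \<and> mat_adjoint W * W = 1\<^sub>m n \<and> col W 0 = k \<cdot>\<^sub>v v"
proof -
  interpret cof_vec_space n "TYPE(complex)" .
  define ws where "ws = gram_schmidt n (basis_completion v)"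
  note bc = basis_completion[OF v v0]
  have n: "0 < n" using v v0 by (cases n) auto
  have ws: "set ws \<subseteq> carrier_vec n" "corthogonal ws" "length ws = n"
    using gram_schmidt_result[OF bc(2,4,5) refl] bc(6) by (auto simp: ws_def)
  obtain vs where bv: "basis_completion v = v # vs"
    using bc(6,7) n by (cases "basis_completion v") auto
  have hd: "ws ! 0 = v"
    using gram_schmidt_hd[OF v, of vs] ws(3) n by (metis bv hd_conv_nth length_greater_0_conv ws_def)
  have wsc: "ws ! i \<in> carrier_vec n" if "i < n" for i using ws that by auto
  \<comment> \<open>The reciprocal norm. The inner product is complex-valued, so its real part is
    taken before the square root; it is shown below to be real and positive.\<close>
  define k where "k i = complex_of_real (1 / sqrt (Re (ws ! i \<bullet>c ws ! i)))" for i
  have kk: "k i * cnj (k i) * (ws ! i \<bullet>c ws ! i) = 1" if i: "i < n" for i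
  proof -
    have "ws ! i \<bullet>c ws ! i \<noteq> 0" using corthogonalD[OF ws(2), of i i] ws(3) i by auto
    moreover have "ws ! i \<bullet>c ws ! i \<ge> 0" by (rule conjugate_square_ge_0_vec)
    ultimately have *: "Re (ws ! i \<bullet>c ws ! i) > 0" "Im (ws ! i \<bullet>c ws ! i) = 0"
      by (auto simp: less_eq_complex_def complex_eq_iff)
    have "k i * cnj (k i) = of_real (1 / Re (ws ! i \<bullet>c ws ! i))"
      using *(1) by (simp add: k_def flip: of_real_mult)
    moreover have "ws ! i \<bullet>c ws ! i = of_real (Re (ws ! i \<bullet>c ws ! i))"
      using *(2) by (simp add: complex_eq_iff)
    ultimately show ?thesis using *(1) by (metis nonzero_eq_divide_eq less_irrefl of_real_1 of_real_mult)
  qed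
  define W where "W = mat n n (\<lambda>(i, j). k j * ws ! j $ i)"
  have W: "W \<in> carrier_mat n n" by (simp add: W_def)
  have dot: "(\<Sum>l<n. ws ! i $ l * cnj (ws ! j $ l)) = ws ! i \<bullet>c ws ! j" if "i < n" "j < n" for i j
    using wsc[OF that(1)] wsc[OF that(2)] by (simp add: scalar_prod_def atLeast0LessThan)
  have "mat_adjoint W * W = 1\<^sub>m n"
  proof (rule eq_matI)
    fix i j assume "i < dim_row (1\<^sub>m n :: complex mat)" "j < dim_col (1\<^sub>m n :: complex mat)"
    hence ij: "i < n" "j < n" by auto
    have "(mat_adjoint W * W) $$ (i, j) = (\<Sum>l<n. cnj (W $$ (l, i)) * W $$ (l, j))"
      using W ij by (subst mat_mult_index[of _ n n _ n]) auto
    also have "\<dots> = cnj (k i) * k j * (\<Sum>l<n. ws ! j $ l * cnj (ws ! i $ l))"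
      unfolding sum_distrib_left using ij by (intro sum.cong) (auto simp: W_def)
    also have "\<dots> = cnj (k i) * k j * (ws ! j \<bullet>c ws ! i)" using dot ij by simp
    also have "\<dots> = (if i = j then 1 else 0)"
      using kk[of i] corthogonalD[OF ws(2), of j i] ij ws(3) by (auto simp: mult_ac)
    finally show "(mat_adjoint W * W) $$ (i, j) = 1\<^sub>m n $$ (i, j)" using ij by auto
  qed (use W in auto)
  moreover have "col W 0 = k 0 \<cdot>\<^sub>v v"
    using n v hd by (intro eq_vecI) (auto simp: W_def)
  ultimately show ?thesis using W by blast
qed

text \<open>Induction on the dimension. Conjugation by a unitary whose first column is an
  eigenvector makes the first column of \<open>A\<close> a multiple of the first basis vector; being
  Hermitian, the result also has zeros in the rest of its first row. So it splits as e plus a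
  smaller Hermitian block \<open>C\<close>.\<close>

theorem hermitian_diagonalisation:
  assumes "(A :: complex mat) \<in> carrier_mat n n" "mat_adjoint A = A"
  shows "\<exists>U D. U \<in> carrier_mat n n \<and> D \<in> carrier_mat n n \<and> mat_adjoint U * U = 1\<^sub>m n \<and>
    U * mat_adjoint U = 1\<^sub>m n \<and> diagonal_mat D \<and> A = U * D * mat_adjoint U"
  using assms
proof (induction n arbitrary: A)
  case 0
  show ?case
    by (rule exI[of _ "1\<^sub>m 0"], rule exI[of _ A])
       (use 0 in \<open>auto simp: diagonal_mat_def intro!: eq_matI\<close>)
next
  case (Suc n A)
  note A = Suc.prems(1)
  obtain as where as: "char_poly A = (\<Prod>a\<leftarrow>as. [:- a, 1:])" "length as = Suc n"
    using char_poly_factorized[OF A] by blast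
  obtain e as' where "as = e # as'" using as(2) by (cases as) auto
  hence "eigenvalue A e" by (simp add: eigenvalue_root_char_poly[OF A] as(1))
  then obtain v where v: "v \<in> carrier_vec (Suc n)" "v \<noteq> 0\<^sub>v (Suc n)" "A *\<^sub>v v = e \<cdot>\<^sub>v v"
    using A by (auto simp: eigenvalue_def eigenvector_def)
  obtain W k where W: "W \<in> carrier_mat (Suc n) (Suc n)" "mat_adjoint W * W = 1\<^sub>m (Suc n)"
    "col W 0 = k \<cdot>\<^sub>v v"
    using exists_unitary_first_column[OF v(1,2)] by blast
  have W': "W * mat_adjoint W = 1\<^sub>m (Suc n)"
    using mat_mult_left_right_inverse[OF mat_adjoint_carrier[OF W(1)] W(1,2)] .
  define B where "B = mat_adjoint W * A * W"
  have B: "B \<in> carrier_mat (Suc n) (Suc n)" using A W by (simp add: B_def)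
  have Bh: "mat_adjoint B = B"
    unfolding B_def using A W Suc.prems(2)
    by (simp add: mat_adjoint_mult[of _ "Suc n" "Suc n" _ "Suc n"] assoc_mult_mat[of _ "Suc n" "Suc n" _ "Suc n" _ "Suc n"])
  have AB: "A = W * B * mat_adjoint W"
  proof -
    have "W * B * mat_adjoint W = (W * mat_adjoint W) * A * (W * mat_adjoint W)"
      unfolding B_def using A W(1)
      by (simp add: assoc_mult_mat[of _ "Suc n" "Suc n" _ "Suc n" _ "Suc n"])
    thus ?thesis using A W' by simp
  qed
  have colB: "B $$ (i, 0) = (if i = 0 then e else 0)" if i: "i < Suc n" for i
  proof -
    \<comment> \<open>The first column of \<open>W\<close> is a multiple of \<open>v\<close>, so it
      is still mapped to \<open>e\<close> times itself. Hence the first column of \<open>B\<close>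
      is \<open>e\<close> times that of \<open>mat_adjoint W * W\<close>, the identity.\<close>
    have "col (A * W) 0 = e \<cdot>\<^sub>v col W 0"
      using A W v by (subst col_mult2[of _ "Suc n" "Suc n" _ "Suc n"])
        (auto simp: mult_mat_vec smult_smult_assoc mult.commute)
    hence AW: "(A * W) $$ (l, 0) = e * W $$ (l, 0)" if "l < Suc n" for l
      using A W(1) that by (metis carrier_matD col_def index_col index_mult_mat(2,3) index_smult_vec(1) dim_col zero_less_Suc)
    have "B $$ (i, 0) = (mat_adjoint W * (A * W)) $$ (i, 0)"
      unfolding B_def using A W by (simp add: assoc_mult_mat[of _ "Suc n" "Suc n" _ "Suc n" _ "Suc n"])
    also have "\<dots> = (\<Sum>l<Suc n. mat_adjoint W $$ (i, l) * (A * W) $$ (l, 0))"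
      using A W i by (intro mat_mult_index) auto
    also have "\<dots> = e * (\<Sum>l<Suc n. mat_adjoint W $$ (i, l) * W $$ (l, 0))"
      unfolding sum_distrib_left by (intro sum.cong) (auto simp: AW)
    also have "(\<Sum>l<Suc n. mat_adjoint W $$ (i, l) * W $$ (l, 0)) = (mat_adjoint W * W) $$ (i, 0)"
      using W i by (intro mat_mult_index[symmetric]) auto
    finally show ?thesis using W(2) i by auto
  qed
  have rowB: "B $$ (0, i) = 0" if i: "i < Suc n" "i \<noteq> 0" for i
  proof -
    have "B $$ (0, i) = mat_adjoint B $$ (0, i)" using Bh by simp
    also have "\<dots> = conjugate (B $$ (i, 0))" using B i by (intro mat_adjoint_index) auto
    finally show ?thesis using colB i by simp
  qed
  define C where "C = mat n n (\<lambda>(i, j). B $$ (Suc i, Suc j))"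
  have C: "C \<in> carrier_mat n n" by (simp add: C_def)
  have "mat_adjoint C = C"
  proof (rule eq_matI)
    fix i j assume ij: "i < dim_row C" "j < dim_col C"
    have "mat_adjoint B $$ (Suc i, Suc j) = B $$ (Suc i, Suc j)" using Bh by simp
    thus "mat_adjoint C $$ (i, j) = C $$ (i, j)" using ij B by (auto simp: C_def)
  qed (auto simp: C_def)
  from Suc.IH[OF C this] obtain U D where U: "U \<in> carrier_mat n n" "D \<in> carrier_mat n n"
    "mat_adjoint U * U = 1\<^sub>m n" "U * mat_adjoint U = 1\<^sub>m n" "diagonal_mat D"
    "C = U * D * mat_adjoint U" by blast
  \<comment> \<open>Extends an operator on the smaller space by the identity on the eigenvector; the
    diagonalising unitary of \<open>A\<close> is then \<open>W * Z U\<close>.\<close>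
  define Z where "Z X = four_block_mat (1\<^sub>m 1) (0\<^sub>m 1 n) (0\<^sub>m n 1) X" for X :: "complex mat"
  define D' where "D' = four_block_mat (mat 1 1 (\<lambda>_. e)) (0\<^sub>m 1 n) (0\<^sub>m n 1) D"
  have Z: "Z X \<in> carrier_mat (Suc n) (Suc n)" if "X \<in> carrier_mat n n" for X
    using that four_block_carrier_mat[of "1\<^sub>m 1" 1 1 X n n] by (simp add: Z_def)
  have D': "D' \<in> carrier_mat (Suc n) (Suc n)"
    using U(2) four_block_carrier_mat[of "mat 1 1 (\<lambda>_. e)" 1 1 D n n] by (simp add: D'_def)
  have Zadj: "mat_adjoint (Z U) = Z (mat_adjoint U)"
    using U(1) unfolding Z_def by (subst mat_adjoint_four_block) auto
  have Zone: "Z (1\<^sub>m n) = 1\<^sub>m (Suc n)" by (rule eq_matI) (auto simp: Z_def)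
  have BZ: "B = Z U * D' * mat_adjoint (Z U)"
  proof -
    have "B = four_block_mat (mat 1 1 (\<lambda>_. e)) (0\<^sub>m 1 n) (0\<^sub>m n 1) C"
      by (rule eq_matI) (use B colB rowB in \<open>auto simp: C_def\<close>)
    also have "\<dots> = Z U * D' * mat_adjoint (Z U)"
      unfolding Zadj unfolding Z_def D'_def using U
      by (simp add: mult_four_block_diag[where n = 1 and m = n] del: One_nat_def)
    finally show ?thesis .
  qed
  define V where "V = W * Z U"
  have V: "V \<in> carrier_mat (Suc n) (Suc n)" using W Z U by (simp add: V_def)
  have adjV: "mat_adjoint V = mat_adjoint (Z U) * mat_adjoint W"
    unfolding V_def using W Z U by (intro mat_adjoint_mult) auto
  have ZU: "mat_adjoint (Z U) * Z U = 1\<^sub>m (Suc n)"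
    unfolding Zadj using U unfolding Zone[symmetric] Z_def
    by (simp add: mult_four_block_diag[where n = 1 and m = n] del: One_nat_def)
  have VV: "mat_adjoint V * V = 1\<^sub>m (Suc n)"
  proof -
    have "mat_adjoint V * V = mat_adjoint (Z U) * (mat_adjoint W * W) * Z U"
      unfolding adjV unfolding V_def using W(1) Z[OF U(1)]
      by (simp add: assoc_mult_mat[of _ "Suc n" "Suc n" _ "Suc n" _ "Suc n"])
    thus ?thesis using W(2) Z[OF U(1)] ZU by simp
  qed
  have "A = V * D' * mat_adjoint V"
    unfolding adjV unfolding AB BZ V_def using W(1) Z[OF U(1)] D'
    by (simp add: assoc_mult_mat[of _ "Suc n" "Suc n" _ "Suc n" _ "Suc n"])
  moreover have "diagonal_mat D'"
    using U(2,5) by (auto simp: diagonal_mat_def D'_def)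
  moreover have "V * mat_adjoint V = 1\<^sub>m (Suc n)"
    using mat_mult_left_right_inverse[OF mat_adjoint_carrier[OF V] V VV] .
  ultimately show ?case using V D' VV by blast
qed

subsection \<open>Tracial correlations\<close>

definition real_diag :: "nat \<Rightarrow> (nat \<Rightarrow> real) \<Rightarrow> complex mat" where
  "real_diag d f = mat d d (\<lambda>(i, j). if i = j then of_real (f i) else 0)"

lemma real_diag_carrier [simp]: "real_diag d f \<in> carrier_mat d d"
  by (simp add: real_diag_def)

lemma mat_adjoint_real_diag [simp]: "mat_adjoint (real_diag d f) = real_diag d f"
  by (rule eq_matI) (auto simp: real_diag_def)

lemma mult_real_diag_index:
  assumes "A \<in> carrier_mat d d" "i < d" "j < d"
  shows "(A * real_diag d f) $$ (i, j) = A $$ (i, j) * of_real (f j)"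
proof -
  have "(A * real_diag d f) $$ (i, j) = (\<Sum>l<d. if l = j then A $$ (i, j) * of_real (f j) else 0)"
    unfolding mat_mult_index[OF assms(1) real_diag_carrier assms(2,3)]
    using assms by (intro sum.cong) (auto simp: real_diag_def)
  thus ?thesis using assms by simp
qed

lemma real_diag_mult_index:
  assumes "A \<in> carrier_mat d d" "i < d" "j < d"
  shows "(real_diag d f * A) $$ (i, j) = of_real (f i) * A $$ (i, j)"
proof -
  have "(real_diag d f * A) $$ (i, j) = (\<Sum>l<d. if l = i then of_real (f i) * A $$ (i, j) else 0)"
    unfolding mat_mult_index[OF real_diag_carrier assms]
    using assms by (intro sum.cong) (auto simp: real_diag_def)
  thus ?thesis using assms by simp
qed

text \<open>The functional A \<mapsto> Tr(A \<rho>) for the diagonal matrix \<rho> with entries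
  \<open>\<delta>\<close>; it is a state when \<open>\<delta>\<close> is nonnegative with sum
  1.\<close>

definition weighted_trace :: "nat \<Rightarrow> (nat \<Rightarrow> real) \<Rightarrow> complex mat \<Rightarrow> complex" where
  "weighted_trace d \<delta> A = (\<Sum>i<d. of_real (\<delta> i) * A $$ (i, i))"

lemma weighted_trace_eq_mtrace:
  assumes "A \<in> carrier_mat d d"
  shows "weighted_trace d \<delta> A = mtrace (A * real_diag d \<delta>)"
  unfolding weighted_trace_def mtrace_def using assms
  by (auto simp: mult_real_diag_index[OF assms] mult.commute simp del: index_mult_mat(1) intro!: sum.cong)

lemma weighted_trace_diff:
  assumes "A \<in> carrier_mat d d" "B \<in> carrier_mat d d"
  shows "weighted_trace d \<delta> (A - B) = weighted_trace d \<delta> A - weighted_trace d \<delta> B"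
  unfolding weighted_trace_def using assms by (auto simp: algebra_simps sum_subtractf)

text \<open>Vanishing of \<open>A $$ (i, j)\<close> for \<open>\<delta> i \<noteq> \<delta> j\<close> says that \<open>A\<close> commutes with the density matrix
  \<open>real_diag d \<delta>\<close>.  The marginal at \<open>v\<close> is \<open>c v v\<close>, because \<open>P v * P v = P v\<close>.\<close>

definition tracial :: "nat \<Rightarrow> (nat \<Rightarrow> nat \<Rightarrow> real) \<Rightarrow> bool" where
  "tracial n c \<longleftrightarrow> (\<exists>d P \<delta>.
     (\<forall>v\<in>{1..n}. projection d (P v) \<and> (\<forall>i<d. \<forall>j<d. \<delta> i \<noteq> \<delta> j \<longrightarrow> P v $$ (i, j) = 0)) \<and>
     (\<forall>i<d. 0 \<le> \<delta> i) \<and> (\<Sum>i<d. \<delta> i) = 1 \<and>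
     (\<forall>v\<in>{1..n}. \<forall>w\<in>{1..n}. complex_of_real (c v w) = weighted_trace d \<delta> (P v * P w)))"

text \<open>The four cases are the values of the state on P Q, P (1 - Q), (1 - P) Q and (1 - P) (1 -
  Q) with P = \<open>P v\<close> and Q = \<open>P w\<close>, all of them affine in
  \<open>c\<close>.\<close>

definition correlation :: "nat \<Rightarrow> (nat \<Rightarrow> nat \<Rightarrow> real) \<Rightarrow> tuple" where
  "correlation n c = (\<lambda>(i, j, v, w)\<in>indices n.
     if i = 0 then if j = 0 then c v w else c v v - c v w
     else if j = 0 then c w w - c v w else 1 - c v v - c w w + c v w)"

section \<open>Projections under transposition and complement\<close>

lemma projectionD:
  assumes "projection d P"
  shows "P \<in> carrier_mat d d" "P * P = P" "mat_adjoint P = P"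
  using assms by (auto simp: projection_def)

lemma projection_transpose:
  assumes "projection d P"
  shows "projection d (transpose_mat P)"
proof -
  note P = projectionD[OF assms]
  have "mat_adjoint (transpose_mat P) = transpose_mat (mat_adjoint P)"
    by (rule eq_matI) auto
  moreover have "transpose_mat P * transpose_mat P = transpose_mat P"
    using transpose_mult[OF P(1) P(1)] P(2) by simp
  ultimately show ?thesis using P by (simp add: projection_def)
qed

lemma projection_complement:
  assumes "projection d P"
  shows "projection d (1\<^sub>m d - P)"
proof -
  note P = projectionD[OF assms]
  have "(1\<^sub>m d - P) * (1\<^sub>m d - P) = 1\<^sub>m d - P"
  proof -
    have Q: "1\<^sub>m d - P \<in> carrier_mat d d" using P(1) by (rule minus_carrier_mat)
    have "(1\<^sub>m d - P) * (1\<^sub>m d - P) = (1\<^sub>m d - P) - (P - P)"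
      using P(2) left_mult_one_mat[OF Q] right_mult_one_mat[OF P(1)]
        minus_mult_distrib_mat[OF one_carrier_mat P(1) Q]
        mult_minus_distrib_mat[OF P(1) one_carrier_mat P(1)] by simp
    thus ?thesis using P(1) by (auto intro!: eq_matI)
  qed
  moreover have "mat_adjoint (1\<^sub>m d - P) = 1\<^sub>m d - P"
  proof (rule eq_matI)
    fix i j assume ij: "i < dim_row (1\<^sub>m d - P)" "j < dim_col (1\<^sub>m d - P)"
    have "mat_adjoint P $$ (i, j) = P $$ (i, j)" using P(3) by simp
    thus "mat_adjoint (1\<^sub>m d - P) $$ (i, j) = (1\<^sub>m d - P) $$ (i, j)" using ij P(1) by (auto simp: complex_eq_iff)
  qed (use P in auto)
  ultimately show ?thesis using minus_carrier_mat[OF P(1)] by (simp add: projection_def)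
qed

section \<open>Vectors of a tensor product as matrices\<close>

lemma sum_div_mod:
  fixes f :: "nat \<Rightarrow> nat \<Rightarrow> 'a :: comm_monoid_add"
  shows "(\<Sum>m<a * b. f (m div b) (m mod b)) = (\<Sum>i<a. \<Sum>k<b. f i k)"
proof -
  have *: "i * b + k < a * b" if "i < a" "k < b" for i k
  proof -
    have "i * b + k < Suc i * b" using that by simp
    also have "\<dots> \<le> a * b" using that by (intro mult_le_mono1) auto
    finally show ?thesis .
  qed
  have "(\<Sum>m<a * b. f (m div b) (m mod b)) = (\<Sum>(i, k)\<in>{..<a} \<times> {..<b}. f i k)"
  proof (rule sum.reindex_bij_witness[of _ "\<lambda>(i, k). i * b + k" "\<lambda>m. (m div b, m mod b)"])
    fix m assume m: "m \<in> {..<a * b}"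
    hence "b > 0" by (cases b) auto
    thus "(m div b, m mod b) \<in> {..<a} \<times> {..<b}"
      using m by (auto simp: less_mult_imp_div_less)
  qed (use * in auto)
  thus ?thesis by (simp add: sum.cartesian_product)
qed

text \<open>The usual isomorphism between the tensor product and rectangular matrices: coefficients
  of the product basis become entries, following the index convention \<open>i * b + k\<close>. The
  Hilbert space norm becomes the Hilbert-Schmidt norm.\<close>

definition vec_to_mat :: "nat \<Rightarrow> nat \<Rightarrow> complex vec \<Rightarrow> complex mat" where
  "vec_to_mat a b h = mat a b (\<lambda>(i, k). h $ (i * b + k))"

lemma vec_to_mat_carrier [simp]: "vec_to_mat a b h \<in> carrier_mat a b"
  by (simp add: vec_to_mat_def)

lemma vec_to_mat_index: "m < a * b \<Longrightarrow> vec_to_mat a b h $$ (m div b, m mod b) = h $ m"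
proof -
  assume m: "m < a * b"
  hence "b > 0" by (cases b) auto
  thus ?thesis using m by (simp add: vec_to_mat_def less_mult_imp_div_less)
qed

lemma norm_vec_to_mat:
  assumes "h \<in> carrier_vec (a * b)"
  shows "mtrace (vec_to_mat a b h * mat_adjoint (vec_to_mat a b h)) = h \<bullet>c h"
proof -
  let ?H = "vec_to_mat a b h"
  have "h \<bullet>c h = (\<Sum>m<a * b. ?H $$ (m div b, m mod b) * cnj (?H $$ (m div b, m mod b)))"
    using assms by (auto simp: scalar_prod_def atLeast0LessThan vec_to_mat_index intro!: sum.cong)
  also have "\<dots> = (\<Sum>i<a. \<Sum>k<b. ?H $$ (i, k) * cnj (?H $$ (i, k)))"
    by (rule sum_div_mod)
  also have "\<dots> = mtrace (?H * mat_adjoint ?H)"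
    by (subst mtrace_mult_adjoint[of _ a b]) (auto simp: complex_norm_square simp del: of_real_power)
  finally show ?thesis ..
qed

text \<open>Under the isomorphism the product operator acts as H \<mapsto> A H B^T, with a transpose
  because \<open>B\<close> acts on the column index. The inner product with \<open>h\<close> is then
  a Hilbert-Schmidt inner product with H.\<close>

lemma tensor_mat_form:
  assumes A: "A \<in> carrier_mat a a" and B: "B \<in> carrier_mat b b" and h: "h \<in> carrier_vec (a * b)"
  shows "(tensor_mat A B *\<^sub>v h) \<bullet>c h =
    mtrace (A * vec_to_mat a b h * transpose_mat B * mat_adjoint (vec_to_mat a b h))"
proof -
  define H where "H = vec_to_mat a b h"
  have H: "H \<in> carrier_mat a b" by (simp add: H_def)
  have T: "tensor_mat A B \<in> carrier_mat (a * b) (a * b)"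
    using A B by (simp add: tensor_mat_def)
  have "(tensor_mat A B *\<^sub>v h) \<bullet>c h =
    (\<Sum>m<a * b. (tensor_mat A B *\<^sub>v h) $ m * cnj (H $$ (m div b, m mod b)))"
    unfolding H_def using T h
    by (auto simp: scalar_prod_def atLeast0LessThan vec_to_mat_index intro!: sum.cong)
  also have "\<dots> = (\<Sum>m<a * b. (\<Sum>j<a. \<Sum>l<b. A $$ (m div b, j) * B $$ (m mod b, l) * H $$ (j, l))
      * cnj (H $$ (m div b, m mod b)))"
  proof (rule sum.cong[OF refl])
    fix m assume m: "m \<in> {..<a * b}"
    have "(tensor_mat A B *\<^sub>v h) $ m = (\<Sum>l<a * b. tensor_mat A B $$ (m, l) * h $ l)"
      using T h m by (auto simp: scalar_prod_def atLeast0LessThan)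
    also have "\<dots> = (\<Sum>l<a * b. A $$ (m div b, l div b) * B $$ (m mod b, l mod b) * H $$ (l div b, l mod b))"
      using A B m by (intro sum.cong) (auto simp: tensor_mat_def H_def vec_to_mat_index)
    also have "\<dots> = (\<Sum>j<a. \<Sum>l<b. A $$ (m div b, j) * B $$ (m mod b, l) * H $$ (j, l))"
      by (rule sum_div_mod)
    finally show "(tensor_mat A B *\<^sub>v h) $ m * cnj (H $$ (m div b, m mod b)) =
      (\<Sum>j<a. \<Sum>l<b. A $$ (m div b, j) * B $$ (m mod b, l) * H $$ (j, l)) * cnj (H $$ (m div b, m mod b))"
      by simp
  qed
  also have "\<dots> = (\<Sum>i<a. \<Sum>k<b. (\<Sum>j<a. \<Sum>l<b. A $$ (i, j) * B $$ (k, l) * H $$ (j, l)) * cnj (H $$ (i, k)))"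
    by (rule sum_div_mod)
  also have "\<dots> = (\<Sum>i<a. \<Sum>k<b. (A * H * transpose_mat B) $$ (i, k) * mat_adjoint H $$ (k, i))"
  proof (intro sum.cong refl)
    fix i k assume ik: "i \<in> {..<a}" "k \<in> {..<b}"
    have AH: "A * H \<in> carrier_mat a b" using A H by simp
    have "(A * H * transpose_mat B) $$ (i, k) = (\<Sum>l<b. (A * H) $$ (i, l) * B $$ (k, l))"
      using A B H ik mat_mult_index[OF AH, of "transpose_mat B" b i k] by (auto intro!: sum.cong simp del: index_mult_mat(1))
    also have "\<dots> = (\<Sum>l<b. \<Sum>j<a. A $$ (i, j) * B $$ (k, l) * H $$ (j, l))"
      using ik by (intro sum.cong refl) (simp add: mat_mult_index[OF A H] sum_distrib_left sum_distrib_right mult_ac del: index_mult_mat(1))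
    finally have "(A * H * transpose_mat B) $$ (i, k) = (\<Sum>j<a. \<Sum>l<b. A $$ (i, j) * B $$ (k, l) * H $$ (j, l))"
      by (subst sum.swap)
    thus "(\<Sum>j<a. \<Sum>l<b. A $$ (i, j) * B $$ (k, l) * H $$ (j, l)) * cnj (H $$ (i, k)) =
      (A * H * transpose_mat B) $$ (i, k) * mat_adjoint H $$ (k, i)"
      using ik H by (simp del: index_mult_mat(1))
  qed
  also have "\<dots> = mtrace (A * H * transpose_mat B * mat_adjoint H)"
  proof -
    have X: "A * H * transpose_mat B \<in> carrier_mat a b" using A H B by simp
    show ?thesis unfolding mtrace_def
      using A X H mat_mult_index[OF X mat_adjoint_carrier[OF H]] by (simp del: index_mult_mat(1))
  qed
  finally show ?thesis by (simp add: H_def)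
qed

text \<open>By idempotence and cyclicity of the trace, the given trace is already the squared
  Hilbert-Schmidt norm of \<open>A * H * B\<close>.\<close>

lemma projection_sandwich_eq_0:
  assumes "projection a A" "projection b B" and H: "H \<in> carrier_mat a b"
    and 0: "mtrace (A * H * B * mat_adjoint H) = 0"
  shows "A * H * B = 0\<^sub>m a b"
proof (rule mtrace_mult_adjoint_eq_0)
  note A = projectionD[OF assms(1)] and B = projectionD[OF assms(2)]
  have AH: "A * H \<in> carrier_mat a b" using A H by simp
  show "A * H * B \<in> carrier_mat a b" using A B H by simp
  let ?M = "A * H * B * mat_adjoint H"
  have M: "?M \<in> carrier_mat a a"
    using mult_carrier_mat[OF mult_carrier_mat[OF AH B(1)] mat_adjoint_carrier[OF H]] .
  have "mat_adjoint (A * H * B) = B * (mat_adjoint H * A)"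
    unfolding mat_adjoint_mult[OF AH B(1)] mat_adjoint_mult[OF A(1) H] A(3) B(3) ..
  hence "A * H * B * mat_adjoint (A * H * B) = A * H * (B * B) * mat_adjoint H * A"
    using A(1) B(1) H by (simp add: mult_carrier_mat[of _ a b _ b] mult_carrier_mat[of _ b b _ a] mult_carrier_mat[of _ a b _ a] mult_carrier_mat[of _ a a _ b]
        mult_carrier_mat[of _ b a _ a] assoc_mult_mat[of _ a a _ b _ b] assoc_mult_mat[of _ a b _ b _ b] assoc_mult_mat[of _ a b _ b _ a]
        assoc_mult_mat[of _ a b _ a _ a] assoc_mult_mat[of _ b b _ a _ a] assoc_mult_mat[of _ a a _ b _ a] assoc_mult_mat[of _ a a _ a _ a] assoc_mult_mat[of _ b b _ b _ a])
  hence "mtrace (A * H * B * mat_adjoint (A * H * B)) = mtrace (A * ?M)"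
    using mtrace_comm[OF M A(1)] B(2) by simp
  also have "A * ?M = (A * A) * H * B * mat_adjoint H"
    using A(1) B(1) H by (simp add: mult_carrier_mat[of _ a b _ b] mult_carrier_mat[of _ b b _ a] mult_carrier_mat[of _ a b _ a] mult_carrier_mat[of _ a a _ b]
        mult_carrier_mat[of _ b a _ a] assoc_mult_mat[of _ a a _ b _ b] assoc_mult_mat[of _ a b _ b _ b] assoc_mult_mat[of _ a b _ b _ a]
        assoc_mult_mat[of _ b b _ a _ a] assoc_mult_mat[of _ a a _ b _ a] assoc_mult_mat[of _ a a _ a _ a] assoc_mult_mat[of _ a a _ a _ b] assoc_mult_mat[of _ b b _ b _ a])
  finally show "mtrace (A * H * B * mat_adjoint (A * H * B)) = 0" using A(2) 0 by simp
qed

text \<open>Insert \<open>B + B' = 1\<close> on the right of \<open>A * H\<close> and drop the term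
  with \<open>B'\<close>; then add the vanishing \<open>A' * H * B\<close> and collect
  \<open>A + A' = 1\<close> on the left.\<close>

lemma intertwine:
  assumes "(A :: complex mat) \<in> carrier_mat a a" "A' \<in> carrier_mat a a" "A + A' = 1\<^sub>m a"
    and "B \<in> carrier_mat b b" "B' \<in> carrier_mat b b" "B + B' = 1\<^sub>m b"
    and H: "H \<in> carrier_mat a b" and 0: "A * H * B' = 0\<^sub>m a b" "A' * H * B = 0\<^sub>m a b"
  shows "A * H = H * B"
proof -
  have AH: "A * H \<in> carrier_mat a b" "A' * H \<in> carrier_mat a b" using assms by auto
  have X: "A * H * B \<in> carrier_mat a b" by (rule mult_carrier_mat[OF AH(1) assms(4)])
  have "A * H = A * H * (B + B')" using right_mult_one_mat[OF AH(1)] assms(6) by simp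
  also have "\<dots> = A * H * B + A * H * B'" by (rule mult_add_distrib_mat[OF AH(1) assms(4,5)])
  also have "\<dots> = A * H * B" unfolding 0(1) by (rule right_add_zero_mat[OF X(1)])
  also have "\<dots> = A * H * B + A' * H * B" unfolding 0(2) by (rule right_add_zero_mat[OF X(1), symmetric])
  also have "\<dots> = (A * H + A' * H) * B" by (rule add_mult_distrib_mat[OF AH assms(4), symmetric])
  also have "A * H + A' * H = (A + A') * H" by (rule add_mult_distrib_mat[OF assms(1,2) H, symmetric])
  finally show ?thesis using assms(3) H by simp
qed

text \<open>This is where synchronicity acts. The two traces are the probabilities of unequal
  answers to the same question; their vanishing lets a measurement on the second space be carried
  through \<open>H\<close> to the first, which is how \<open>Q\<close> is eliminated.\<close>

lemma synchronous_intertwine: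
  assumes P: "two_outcome_pvm a P" and Q: "two_outcome_pvm b Q" and H: "H \<in> carrier_mat a b"
    and 0: "mtrace (P 0 * H * transpose_mat (Q 1) * mat_adjoint H) = 0"
      "mtrace (P 1 * H * transpose_mat (Q 0) * mat_adjoint H) = 0"
    and i: "i \<in> {0, 1}"
  shows "P i * H = H * transpose_mat (Q i)"
proof -
  have p: "projection a (P 0)" "projection a (P 1)" "P 0 + P 1 = 1\<^sub>m a"
    using P by (auto simp: two_outcome_pvm_def)
  have q: "projection b (Q 0)" "projection b (Q 1)" "Q 0 + Q 1 = 1\<^sub>m b"
    using Q by (auto simp: two_outcome_pvm_def)
  note P01 = projectionD(1)[OF p(1)] projectionD(1)[OF p(2)]
  note Q01 = projectionD(1)[OF q(1)] projectionD(1)[OF q(2)]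
  have qT: "transpose_mat (Q 0) + transpose_mat (Q 1) = 1\<^sub>m b"
    using transpose_add[OF Q01] q(3) by (metis transpose_one)
  have z: "P 0 * H * transpose_mat (Q 1) = 0\<^sub>m a b" "P 1 * H * transpose_mat (Q 0) = 0\<^sub>m a b"
    using projection_sandwich_eq_0[OF p(1) projection_transpose[OF q(2)] H 0(1)]
      projection_sandwich_eq_0[OF p(2) projection_transpose[OF q(1)] H 0(2)] by auto
  have "P 0 * H = H * transpose_mat (Q 0)"
    using P01 Q01 p(3) qT H z by (intro intertwine[of _ a "P 1" _ b "transpose_mat (Q 1)"]) auto
  moreover have "P 1 * H = H * transpose_mat (Q 1)"
    using P01 Q01 p(3) qT H z comm_add_mat[OF P01]
      comm_add_mat[of "transpose_mat (Q 0)" b b "transpose_mat (Q 1)"]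
    by (intro intertwine[of _ a "P 0" _ b "transpose_mat (Q 0)"]) auto
  ultimately show ?thesis using i by auto
qed

text \<open>Diagonalising the reduced density matrix \<open>\<rho>\<close> brings its commuting projections into the
  form required by \<open>tracial\<close>.\<close>

lemma tracial_of_density:
  assumes \<rho>: "\<rho> = H * mat_adjoint H" and H: "H \<in> carrier_mat a b" and one: "mtrace \<rho> = 1"
    and P: "\<And>v. v \<in> {1..n} \<Longrightarrow> projection a (P v)"
    and comm: "\<And>v. v \<in> {1..n} \<Longrightarrow> P v * \<rho> = \<rho> * P v"
    and c: "\<And>v w. v \<in> {1..n} \<Longrightarrow> w \<in> {1..n} \<Longrightarrow> complex_of_real (c v w) = mtrace (P v * P w * \<rho>)"
  shows "tracial n c"
proof -
  note as = assoc_mult_mat[of _ a a _ a _ a]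
  have rc: "\<rho> \<in> carrier_mat a a" using H \<rho> by simp
  have "mat_adjoint \<rho> = \<rho>" unfolding \<rho> using mat_adjoint_mult[OF H mat_adjoint_carrier[OF H]] by simp
  then obtain U D where U: "U \<in> carrier_mat a a" "D \<in> carrier_mat a a" "mat_adjoint U * U = 1\<^sub>m a"
    "U * mat_adjoint U = 1\<^sub>m a" "diagonal_mat D" "\<rho> = U * D * mat_adjoint U"
    using hermitian_diagonalisation[OF rc] by blast
  let ?V = "mat_adjoint U"
  have V: "?V \<in> carrier_mat a a" using U by simp
  have canc: "U * (?V * X) = X" "?V * (U * X) = X" if "X \<in> carrier_mat a a" for X
    using U V that assoc_mult_mat[OF U(1) V that] assoc_mult_mat[OF V U(1) that] by simp_all
  have D: "D = ?V * \<rho> * U" unfolding U(6) using U V by (simp add: as canc)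
  define \<delta> where "\<delta> i = Re (D $$ (i, i))" for i
  \<comment> \<open>D is X times its adjoint for X = \<open>mat_adjoint U * H\<close>, so its
    diagonal entries are squared norms of rows of X. This yields both that they are real and that
    they are nonnegative.\<close>
  have Dii: "D $$ (i, i) = of_real (\<Sum>j<b. (cmod ((?V * H) $$ (i, j)))\<^sup>2)" if i: "i < a" for i
  proof -
    have X: "?V * H \<in> carrier_mat a b" using V H by simp
    have HU: "mat_adjoint H * U \<in> carrier_mat b a" using mult_carrier_mat[OF mat_adjoint_carrier[OF H] U(1)] .
    have "D = (?V * H) * mat_adjoint (?V * H)"
      unfolding D \<rho> mat_adjoint_mult[OF V H] mat_adjoint_adjoint
      using assoc_mult_mat[OF V H HU] assoc_mult_mat[OF H mat_adjoint_carrier[OF H] U(1)]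
        assoc_mult_mat[OF V rc[unfolded \<rho>] U(1)] by simp
    hence "D $$ (i, i) = (\<Sum>j<b. (?V * H) $$ (i, j) * mat_adjoint (?V * H) $$ (j, i))"
      using mat_mult_index[OF X mat_adjoint_carrier[OF X] i i] by simp
    also have "\<dots> = (\<Sum>j<b. of_real ((cmod ((?V * H) $$ (i, j)))\<^sup>2))"
      using X i by (intro sum.cong refl, subst mat_adjoint_index)
        (auto simp: complex_norm_square simp del: of_real_power index_mult_mat(1))
    finally show ?thesis by simp
  qed
  have \<delta>0: "0 \<le> \<delta> i" and D\<delta>: "D $$ (i, i) = of_real (\<delta> i)" if "i < a" for i
    unfolding \<delta>_def Dii[OF that] by (auto intro: sum_nonneg)
  have Dd: "D = real_diag a \<delta>"
  proof (rule eq_matI)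
    fix i j assume "i < dim_row (real_diag a \<delta>)" "j < dim_col (real_diag a \<delta>)"
    hence "i < a" "j < a" by (auto simp: real_diag_def)
    thus "D $$ (i, j) = real_diag a \<delta> $$ (i, j)"
      using U(2,5) D\<delta> by (auto simp: real_diag_def diagonal_mat_def)
  qed (use U in \<open>auto simp: real_diag_def\<close>)
  have "mtrace D = mtrace \<rho>"
    unfolding D using mtrace_comm[OF V, of "\<rho> * U"] rc U V by (simp add: as canc)
  hence "complex_of_real (\<Sum>i<a. \<delta> i) = 1"
    using one U(2) D\<delta> by (simp add: mtrace_def)
  hence \<delta>1: "(\<Sum>i<a. \<delta> i) = 1" by (metis of_real_eq_1_iff)
  define R where "R v = ?V * P v * U" for v
  note Pc = projectionD[OF P]
  have Rc: "R v \<in> carrier_mat a a" if "v \<in> {1..n}" for v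
    unfolding R_def using Pc(1)[OF that] U V by simp
  have Rp: "projection a (R v)" if v: "v \<in> {1..n}" for v
  proof -
    have "R v * R v = ?V * (P v * P v) * U"
      unfolding R_def using Pc(1)[OF v] U V by (simp add: as canc)
    moreover have "mat_adjoint (R v) = ?V * (mat_adjoint (P v) * U)"
      unfolding R_def using Pc(1)[OF v] U V by (simp add: mat_adjoint_mult[of _ a a _ a])
    ultimately show ?thesis
      using Pc(2,3)[OF v] Rc[OF v] Pc(1)[OF v] U V unfolding projection_def by (simp add: R_def as)
  qed
  \<comment> \<open>Comparing entries of \<open>R v * D\<close> and \<open>D * R v\<close> gives
    \<open>R v $$ (i, j)\<close> multiplied by \<open>\<delta> j\<close> on one side and by
    \<open>\<delta> i\<close> on the other.\<close>
  have Rcomm: "R v $$ (i, j) = 0" if v: "v \<in> {1..n}" and ij: "i < a" "j < a" "\<delta> i \<noteq> \<delta> j" for v i j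
  proof -
    have "R v * D = ?V * (P v * \<rho>) * U" unfolding R_def D using Pc(1)[OF v] U V rc by (simp add: as canc)
    also have "\<dots> = D * R v" unfolding comm[OF v] unfolding R_def D using Pc(1)[OF v] U V rc by (simp add: as canc)
    finally have "(R v * D) $$ (i, j) = (D * R v) $$ (i, j)" by simp
    thus ?thesis unfolding Dd using ij
      by (simp add: mult_real_diag_index[OF Rc[OF v]] real_diag_mult_index[OF Rc[OF v]] del: index_mult_mat(1))
  qed
  have "complex_of_real (c v w) = weighted_trace a \<delta> (R v * R w)" if vw: "v \<in> {1..n}" "w \<in> {1..n}" for v w
  proof -
    note Pvw = Pc(1)[OF vw(1)] Pc(1)[OF vw(2)]
    have "weighted_trace a \<delta> (R v * R w) = mtrace (R v * R w * D)"
      using Rc vw by (simp add: weighted_trace_eq_mtrace Dd)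
    also have "R v * R w * D = ?V * (P v * (P w * (\<rho> * U)))"
      unfolding R_def D using Pvw U V rc by (simp add: as canc)
    also have "mtrace \<dots> = mtrace (P v * (P w * (\<rho> * U)) * ?V)"
      using Pvw U V rc by (intro mtrace_comm[of _ a a]) auto
    also have "P v * (P w * (\<rho> * U)) * ?V = P v * P w * \<rho> * (U * ?V)"
      using Pvw U(1) V rc by (simp add: as)
    finally show ?thesis using c[OF vw] U(4) Pvw rc right_mult_one_mat[of "P v * P w * \<rho>" a a] by simp
  qed
  thus ?thesis unfolding tracial_def using Rp Rcomm \<delta>0 \<delta>1 by blast
qed

text \<open>With H the matrix of \<open>h\<close>, the reduced density matrix of the first space is
  \<rho> = H (adj H). Intertwining replaces each \<open>Q w j\<close> by \<open>P w j\<close> and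
  turns the probabilities into Tr(\<open>P v i\<close> \<open>P w j\<close> \<rho>).\<close>

lemma C_q_s_imp_tracial:
  assumes "p \<in> C_q_s n"
  shows "\<exists>c. tracial n c \<and> p = correlation n c"
proof -
  have ext: "p \<in> extensional (indices n)" and sync: "synchronous n p" and "p \<in> C_q n"
    using assms by (auto simp: C_q_s_def C_q_def)
  then obtain a b P Q h where P: "\<forall>v\<in>{1..n}. two_outcome_pvm a (P v)"
    and Q: "\<forall>w\<in>{1..n}. two_outcome_pvm b (Q w)" and h: "h \<in> carrier_vec (a * b)" "h \<bullet>c h = 1"
    and p: "\<forall>(i, j, v, w)\<in>indices n.
          complex_of_real (p (i, j, v, w)) = (tensor_mat (P v i) (Q w j) *\<^sub>v h) \<bullet>c h"
    unfolding C_q_def by blast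
  define H where "H = vec_to_mat a b h"
  define \<rho> where "\<rho> = H * mat_adjoint H"
  have H: "H \<in> carrier_mat a b" by (simp add: H_def)
  have rc: "\<rho> \<in> carrier_mat a a" using H by (simp add: \<rho>_def)
  have one: "mtrace \<rho> = 1" using norm_vec_to_mat[OF h(1)] h(2) by (simp add: \<rho>_def H_def)
  have Pp: "projection a (P v i)" if "v \<in> {1..n}" "i \<in> {0, 1}" for v i
    using P that by (auto simp: two_outcome_pvm_def)
  have Qp: "projection b (Q v i)" if "v \<in> {1..n}" "i \<in> {0, 1}" for v i
    using Q that by (auto simp: two_outcome_pvm_def)
  note Pc = projectionD(1)[OF Pp] and Qc = projectionD(1)[OF Qp]
  have val: "complex_of_real (p (i, j, v, w)) = mtrace (P v i * H * transpose_mat (Q w j) * mat_adjoint H)"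
    if "v \<in> {1..n}" "w \<in> {1..n}" "i \<in> {0, 1}" "j \<in> {0, 1}" for v w i j
  proof -
    have "(i, j, v, w) \<in> indices n" using that by (auto simp: indices_def)
    hence "complex_of_real (p (i, j, v, w)) = (tensor_mat (P v i) (Q w j) *\<^sub>v h) \<bullet>c h" using p by blast
    also have "\<dots> = mtrace (P v i * H * transpose_mat (Q w j) * mat_adjoint H)"
      unfolding H_def using tensor_mat_form[OF Pc[OF that(1,3)] Qc[OF that(2,4)] h(1)] .
    finally show ?thesis .
  qed
  have inter: "P v i * H = H * transpose_mat (Q v i)" if v: "v \<in> {1..n}" and i: "i \<in> {0, 1}" for v i
  proof (rule synchronous_intertwine[OF _ _ H _ _ i])
    have "p (0, 1, v, v) = 0" "p (1, 0, v, v) = 0"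
      using sync v by (auto simp: synchronous_def)
    thus "mtrace (P v 0 * H * transpose_mat (Q v 1) * mat_adjoint H) = 0"
      "mtrace (P v 1 * H * transpose_mat (Q v 0) * mat_adjoint H) = 0"
      using val[OF v v, of 0 1] val[OF v v, of 1 0] by simp_all
  qed (use P Q v in auto)
  have val2: "complex_of_real (p (i, j, v, w)) = mtrace (P v i * P w j * \<rho>)"
    if vw: "v \<in> {1..n}" "w \<in> {1..n}" and ij: "i \<in> {0, 1}" "j \<in> {0, 1}" for v w i j
  proof -
    note A = Pc[OF vw(1) ij(1)] and B = Pc[OF vw(2) ij(2)] and C = Qc[OF vw(2) ij(2)]
    have CT: "transpose_mat (Q w j) \<in> carrier_mat b b" using C by simp
    have "P v i * H * transpose_mat (Q w j) = P v i * (P w j * H)"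
      unfolding inter[OF vw(2) ij(2)] by (rule assoc_mult_mat[OF A H CT])
    also have "\<dots> = P v i * P w j * H" by (rule assoc_mult_mat[OF A B H, symmetric])
    finally have "P v i * H * transpose_mat (Q w j) * mat_adjoint H = P v i * P w j * H * mat_adjoint H" by simp
    also have "\<dots> = P v i * P w j * \<rho>"
      unfolding \<rho>_def by (rule assoc_mult_mat[OF mult_carrier_mat[OF A B] H mat_adjoint_carrier[OF H]])
    finally show ?thesis using val[OF vw ij] by simp
  qed
  \<comment> \<open>The intertwining relation and its adjoint bring both products to the same form:
    H, then the transpose of \<open>Q v i\<close>, then the adjoint of H.\<close>
  have comm: "P v i * \<rho> = \<rho> * P v i" if v: "v \<in> {1..n}" and i: "i \<in> {0, 1}" for v i
  proof -
    note A = projectionD[OF Pp[OF v i]] and B = projectionD[OF projection_transpose[OF Qp[OF v i]]]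
    have "mat_adjoint (P v i * H) = mat_adjoint (H * transpose_mat (Q v i))" using inter[OF v i] by simp
    hence "mat_adjoint H * P v i = transpose_mat (Q v i) * mat_adjoint H"
      unfolding mat_adjoint_mult[OF A(1) H] mat_adjoint_mult[OF H B(1)] A(3) B(3) .
    hence "\<rho> * P v i = H * (transpose_mat (Q v i) * mat_adjoint H)"
      unfolding \<rho>_def using assoc_mult_mat[OF H mat_adjoint_carrier[OF H] A(1)] by simp
    also have "\<dots> = P v i * H * mat_adjoint H"
      unfolding inter[OF v i] by (rule assoc_mult_mat[OF H B(1) mat_adjoint_carrier[OF H], symmetric])
    also have "\<dots> = P v i * \<rho>" unfolding \<rho>_def by (rule assoc_mult_mat[OF A(1) H mat_adjoint_carrier[OF H]])
    finally show ?thesis ..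
  qed
  define c where "c v w = p (0, 0, v, w)" for v w
  have tr: "tracial n c"
    using Pp comm val2 by (intro tracial_of_density[OF \<rho>_def H one, of n "\<lambda>v. P v 0"]) (auto simp: c_def)
  have sum1: "P v 0 + P v 1 = 1\<^sub>m a" if "v \<in> {1..n}" for v
    using P that by (auto simp: two_outcome_pvm_def)
  have lin: "mtrace (P v 0 * X) + mtrace (P v 1 * X) = mtrace X" if v: "v \<in> {1..n}" and X: "X \<in> carrier_mat a a" for v X
  proof -
    have 01: "P v 0 \<in> carrier_mat a a" "P v 1 \<in> carrier_mat a a" using Pc[OF v] by auto
    have "mtrace (P v 0 * X) + mtrace (P v 1 * X) = mtrace (P v 0 * X + P v 1 * X)"
      using 01 X by (subst mtrace_add[of _ a]) auto
    also have "P v 0 * X + P v 1 * X = (P v 0 + P v 1) * X"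
      using add_mult_distrib_mat[OF 01 X] by simp
    finally show ?thesis using sum1[OF v] X by simp
  qed
  \<comment> \<open>\<open>lin\<close> sums over the leftmost factor. Commutation with \<rho> and
    cyclicity move \<open>P w j\<close> to that place.\<close>
  have row: "mtrace (P v i * P w 0 * \<rho>) + mtrace (P v i * P w 1 * \<rho>) = mtrace (P v i * \<rho>)"
    if v: "v \<in> {1..n}" and w: "w \<in> {1..n}" and i: "i \<in> {0, 1}" for v w i
  proof -
    note A = Pc[OF v i]
    have "mtrace (P v i * P w j * \<rho>) = mtrace (P w j * (P v i * \<rho>))" if j: "j \<in> {0, 1}" for j
    proof -
      note B = Pc[OF w j]
      have "P v i * P w j * \<rho> = P v i * \<rho> * P w j"
        using A B rc by (simp add: assoc_mult_mat[of _ a a _ a _ a] comm[OF w j])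
      thus ?thesis using mtrace_comm[of "P v i * \<rho>" a a "P w j"] A B rc by simp
    qed
    thus ?thesis using lin[OF w, of "P v i * \<rho>"] A rc by simp
  qed
  have column: "mtrace (P v 0 * P w j * \<rho>) + mtrace (P v 1 * P w j * \<rho>) = mtrace (P w j * \<rho>)"
    if v: "v \<in> {1..n}" and w: "w \<in> {1..n}" and j: "j \<in> {0, 1}" for v w j
  proof -
    note B = Pc[OF w j]
    have "P v i * P w j * \<rho> = P v i * (P w j * \<rho>)" if "i \<in> {0, 1}" for i
      using assoc_mult_mat[OF Pc[OF v that] B rc] .
    thus ?thesis using lin[OF v, of "P w j * \<rho>"] B rc by simp
  qed
  have diag: "complex_of_real (c v v) = mtrace (P v 0 * \<rho>)" if v: "v \<in> {1..n}" for v
    using val2[OF v v, of 0 0] projectionD(2)[OF Pp[OF v, of 0]] by (simp add: c_def)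
  have "p (i, j, v, w) = correlation n c (i, j, v, w)" if ijvw: "(i, j, v, w) \<in> indices n" for i j v w
  proof -
    have vw: "v \<in> {1..n}" "w \<in> {1..n}" and ij: "i \<in> {0, 1}" "j \<in> {0, 1}"
      using ijvw by (auto simp: indices_def)
    note val2 = val2[OF vw, simplified] and diag = diag[OF vw(1)] diag[OF vw(2)]
    \<comment> \<open>Three marginal relations express the entries other than p(0,0|v,w) through
      \<open>c\<close>, in the shape prescribed by \<open>correlation\<close>.\<close>
    have "complex_of_real (p (0, 0, v, w) + p (0, 1, v, w)) = of_real (c v v)"
      using row[OF vw, of 0] diag(1) val2 by simp
    hence 1: "p (0, 0, v, w) + p (0, 1, v, w) = c v v" by (rule of_real_eq_iff[THEN iffD1])
    have "complex_of_real (p (0, 0, v, w) + p (1, 0, v, w)) = of_real (c w w)"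
      using column[OF vw, of 0] diag(2) val2 by simp
    hence 2: "p (0, 0, v, w) + p (1, 0, v, w) = c w w" by (rule of_real_eq_iff[THEN iffD1])
    have "complex_of_real (c v v + p (1, 0, v, w) + p (1, 1, v, w)) = of_real 1"
      using row[OF vw, of 1] lin[OF vw(1) rc] diag(1) val2 one by (simp add: add.assoc)
    hence 3: "c v v + p (1, 0, v, w) + p (1, 1, v, w) = 1" by (rule of_real_eq_iff[THEN iffD1])
    show ?thesis using ij ijvw 1 2 3 by (auto simp: correlation_def c_def)
  qed
  hence "p = correlation n c"
    by (intro extensionalityI[OF ext]) (auto simp: correlation_def)
  thus ?thesis using tr by blast
qed

text \<open>A matrix without entries between different values of \<open>\<delta>\<close> commutes
  with the entrywise square root of the weights, so the two square roots meet and multiply to the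
  density matrix.\<close>

lemma weighted_trace_real_diag_form:
  assumes A: "A \<in> carrier_mat d d" and B: "B \<in> carrier_mat d d"
    and comm: "\<And>i j. i < d \<Longrightarrow> j < d \<Longrightarrow> \<delta> i \<noteq> \<delta> j \<Longrightarrow> B $$ (i, j) = 0"
    and \<delta>: "\<And>i. i < d \<Longrightarrow> 0 \<le> \<delta> i"
  shows "mtrace (A * real_diag d (\<lambda>i. sqrt (\<delta> i)) * B * real_diag d (\<lambda>i. sqrt (\<delta> i))) =
    weighted_trace d \<delta> (A * B)"
proof -
  let ?S = "real_diag d (\<lambda>i. sqrt (\<delta> i))"
  note as = assoc_mult_mat[of _ d d _ d _ d]
  have BS: "?S * B = B * ?S"
  proof (rule eq_matI)
    fix i j assume "i < dim_row (B * ?S)" "j < dim_col (B * ?S)"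
    hence ij: "i < d" "j < d" using B by (auto simp: real_diag_def)
    show "(?S * B) $$ (i, j) = (B * ?S) $$ (i, j)"
      unfolding mult_real_diag_index[OF B ij] real_diag_mult_index[OF B ij]
      using comm[OF ij] by (cases "\<delta> i = \<delta> j") auto
  qed (use B in \<open>auto simp: real_diag_def\<close>)
  have SS: "?S * ?S = real_diag d \<delta>"
  proof (rule eq_matI)
    fix i j assume "i < dim_row (real_diag d \<delta>)" "j < dim_col (real_diag d \<delta>)"
    hence ij: "i < d" "j < d" by (auto simp: real_diag_def)
    show "(?S * ?S) $$ (i, j) = real_diag d \<delta> $$ (i, j)"
      unfolding mult_real_diag_index[OF real_diag_carrier ij]
      using ij \<delta> by (auto simp: real_diag_def simp flip: of_real_mult)
  qed (auto simp: real_diag_def)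
  have "A * ?S * B * ?S = A * (?S * B) * ?S" using A B by (simp add: as)
  also have "\<dots> = A * B * (?S * ?S)" unfolding BS using A B by (simp add: as)
  finally show ?thesis using A B by (simp add: SS weighted_trace_eq_mtrace)
qed

text \<open>The canonical purification: \<open>h\<close> is the vector whose matrix is the square
  root of the density matrix, and the second party measures the transposes, which cancels the
  transpose in \<open>tensor_mat_form\<close>.\<close>

lemma tracial_imp_C_q_s:
  assumes "tracial n c"
  shows "correlation n c \<in> C_q_s n"
proof -
  obtain d P \<delta> where P: "\<And>v. v \<in> {1..n} \<Longrightarrow> projection d (P v)"
    and comm: "\<And>v i j. v \<in> {1..n} \<Longrightarrow> i < d \<Longrightarrow> j < d \<Longrightarrow> \<delta> i \<noteq> \<delta> j \<Longrightarrow> P v $$ (i, j) = 0"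
    and \<delta>: "\<And>i. i < d \<Longrightarrow> 0 \<le> \<delta> i" "(\<Sum>i<d. \<delta> i) = 1"
    and c: "\<And>v w. v \<in> {1..n} \<Longrightarrow> w \<in> {1..n} \<Longrightarrow> complex_of_real (c v w) = weighted_trace d \<delta> (P v * P w)"
    using assms unfolding tracial_def by metis
  define R where "R v i = (if i = 0 then P v else 1\<^sub>m d - P v)" for v and i :: nat
  have Rp: "projection d (R v i)" if "v \<in> {1..n}" for v i
    using P[OF that] projection_complement by (auto simp: R_def)
  note Pc = projectionD(1)[OF P] and Rc = projectionD(1)[OF Rp]
  have Rcomm: "R v k $$ (i, j) = 0" if "v \<in> {1..n}" "i < d" "j < d" "\<delta> i \<noteq> \<delta> j" for v k i j
    using comm[OF that] Pc[OF that(1)] that(2-) by (auto simp: R_def)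
  have pvm: "two_outcome_pvm d (R v)" if v: "v \<in> {1..n}" for v
  proof -
    have "P v + (1\<^sub>m d - P v) = 1\<^sub>m d" using Pc[OF v] by (intro eq_matI) auto
    thus ?thesis using Rp[OF v, of 0] Rp[OF v, of 1] by (simp add: two_outcome_pvm_def R_def)
  qed
  have pvmT: "two_outcome_pvm d (\<lambda>i. transpose_mat (R v i))" if v: "v \<in> {1..n}" for v
    using projection_transpose[OF Rp[OF v, of 0]] projection_transpose[OF Rp[OF v, of 1]] pvm[OF v]
      transpose_add[OF Rc[OF v, of 0] Rc[OF v, of 1]]
    unfolding two_outcome_pvm_def by (metis transpose_one)
  define S where "S = real_diag d (\<lambda>i. sqrt (\<delta> i))"
  define h where "h = vec (d * d) (\<lambda>m. S $$ (m div d, m mod d))"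
  have h: "h \<in> carrier_vec (d * d)" by (simp add: h_def)
  have Sh: "vec_to_mat d d h = S"
  proof (rule eq_matI)
    fix i j assume "i < dim_row S" "j < dim_col S"
    hence ij: "i < d" "j < d" by (auto simp: S_def real_diag_def)
    have "i * d + j < Suc i * d" using ij by simp
    also have "\<dots> \<le> d * d" using ij by (intro mult_le_mono1) auto
    finally show "vec_to_mat d d h $$ (i, j) = S $$ (i, j)" using ij by (simp add: vec_to_mat_def h_def)
  qed (auto simp: vec_to_mat_def S_def real_diag_def)
  have Sc: "S \<in> carrier_mat d d" and Sadj: "mat_adjoint S = S" by (simp_all add: S_def)
  have "h \<bullet>c h = mtrace (1\<^sub>m d * S * 1\<^sub>m d * S)"
    using norm_vec_to_mat[OF h] Sc Sadj by (simp add: Sh)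
  also have "\<dots> = weighted_trace d \<delta> (1\<^sub>m d * 1\<^sub>m d)"
    unfolding S_def using \<delta>(1) by (intro weighted_trace_real_diag_form) auto
  also have "\<dots> = of_real (\<Sum>i<d. \<delta> i)" by (simp add: weighted_trace_def)
  finally have h1: "h \<bullet>c h = 1" using \<delta>(2) by simp
  have form: "(tensor_mat (R v i) (transpose_mat (R w j)) *\<^sub>v h) \<bullet>c h = weighted_trace d \<delta> (R v i * R w j)"
    if "v \<in> {1..n}" "w \<in> {1..n}" for v w i j
  proof -
    have T: "transpose_mat (R w j) \<in> carrier_mat d d" using Rc[OF that(2)] by simp
    show ?thesis
      unfolding tensor_mat_form[OF Rc[OF that(1)] T h] Sh Sadj transpose_transpose
      unfolding S_def using that Rc Rcomm \<delta>(1) by (intro weighted_trace_real_diag_form) auto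
  qed
  have val: "complex_of_real (correlation n c (i, j, v, w)) = weighted_trace d \<delta> (R v i * R w j)"
    if ijvw: "(i, j, v, w) \<in> indices n" for i j v w
  proof -
    have vw: "v \<in> {1..n}" "w \<in> {1..n}" and ij: "i \<in> {0, 1}" "j \<in> {0, 1}"
      using ijvw by (auto simp: indices_def)
    note A = Pc[OF vw(1)] and B = Pc[OF vw(2)]
    have A': "1\<^sub>m d - P v \<in> carrier_mat d d" and B': "1\<^sub>m d - P w \<in> carrier_mat d d"
      using A B by (auto intro: minus_carrier_mat)
    have cv: "complex_of_real (c v v) = weighted_trace d \<delta> (P v)"
      "complex_of_real (c w w) = weighted_trace d \<delta> (P w)"
      using c[OF vw(1,1)] c[OF vw(2,2)] projectionD(2)[OF P] vw by auto
    have e: "P v * (1\<^sub>m d - P w) = P v - P v * P w"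
      "(1\<^sub>m d - P v) * P w = P w - P v * P w"
      "(1\<^sub>m d - P v) * (1\<^sub>m d - P w) = (1\<^sub>m d - P v) - (P w - P v * P w)"
      using A B A' B' mult_minus_distrib_mat[OF A one_carrier_mat B] minus_mult_distrib_mat[OF one_carrier_mat A B]
        mult_minus_distrib_mat[OF A' one_carrier_mat B] right_mult_one_mat[OF A] left_mult_one_mat[OF B] right_mult_one_mat[OF A']
      by simp_all
    have AB: "P v * P w \<in> carrier_mat d d" "P w - P v * P w \<in> carrier_mat d d"
      using A B by (auto intro: minus_carrier_mat)
    have one: "weighted_trace d \<delta> (1\<^sub>m d) = 1"
      using \<delta>(2) by (simp add: weighted_trace_def flip: of_real_sum)
    show ?thesis
      using ij ijvw cv c[OF vw] A B A' AB one
      by (auto simp: correlation_def R_def e weighted_trace_diff)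
  qed
  have "correlation n c \<in> C_q n"
    unfolding C_q_def mem_Collect_eq
    using pvm pvmT h h1 form val
    by (intro conjI exI[of _ d] exI[of _ R] exI[of _ "\<lambda>v i. transpose_mat (R v i)"] exI[of _ h])
      (auto simp: correlation_def indices_def)
  moreover have "synchronous n (correlation n c)"
    by (auto simp: synchronous_def correlation_def indices_def)
  ultimately show ?thesis by (simp add: C_q_s_def)
qed

subsection \<open>Decomposition into correlations with rational marginals\<close>

lemma sum_lessThan_add:
  fixes f :: "nat \<Rightarrow> 'a :: comm_monoid_add"
  shows "(\<Sum>i<a + b. f i) = (\<Sum>i<a. f i) + (\<Sum>i<b. f (a + i))"
  by (induction b) (auto simp: add.assoc)

text \<open>Direct sum of the two realisations, with weights scaled by \<open>l\<close> and
  \<open>1 - l\<close>. Commutation survives: entries between the blocks are zero, and inside a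
  block unequal scaled weights come from unequal original ones.\<close>

lemma tracial_mix:
  assumes "tracial n c" "tracial n c'" and l: "0 \<le> l" "l \<le> 1"
  shows "tracial n (\<lambda>v w. l * c v w + (1 - l) * c' v w)"
proof -
  obtain d P \<delta> where P: "\<And>v. v \<in> {1..n} \<Longrightarrow> projection d (P v)"
    and comm: "\<And>v i j. v \<in> {1..n} \<Longrightarrow> i < d \<Longrightarrow> j < d \<Longrightarrow> \<delta> i \<noteq> \<delta> j \<Longrightarrow> P v $$ (i, j) = 0"
    and \<delta>: "\<And>i. i < d \<Longrightarrow> 0 \<le> \<delta> i" "(\<Sum>i<d. \<delta> i) = 1"
    and c: "\<And>v w. v \<in> {1..n} \<Longrightarrow> w \<in> {1..n} \<Longrightarrow> complex_of_real (c v w) = weighted_trace d \<delta> (P v * P w)"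
    using assms(1) unfolding tracial_def by metis
  obtain d' P' \<delta>' where P': "\<And>v. v \<in> {1..n} \<Longrightarrow> projection d' (P' v)"
    and comm': "\<And>v i j. v \<in> {1..n} \<Longrightarrow> i < d' \<Longrightarrow> j < d' \<Longrightarrow> \<delta>' i \<noteq> \<delta>' j \<Longrightarrow> P' v $$ (i, j) = 0"
    and \<delta>': "\<And>i. i < d' \<Longrightarrow> 0 \<le> \<delta>' i" "(\<Sum>i<d'. \<delta>' i) = 1"
    and c': "\<And>v w. v \<in> {1..n} \<Longrightarrow> w \<in> {1..n} \<Longrightarrow> complex_of_real (c' v w) = weighted_trace d' \<delta>' (P' v * P' w)"
    using assms(2) unfolding tracial_def by metis
  define R where "R v = four_block_mat (P v) (0\<^sub>m d d') (0\<^sub>m d' d) (P' v)" for v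
  define \<epsilon> where "\<epsilon> i = (if i < d then l * \<delta> i else (1 - l) * \<delta>' (i - d))" for i
  note Pc = projectionD[OF P] and Pc' = projectionD[OF P']
  have RR: "R v * R w = four_block_mat (P v * P w) (0\<^sub>m d d') (0\<^sub>m d' d) (P' v * P' w)"
    if "v \<in> {1..n}" "w \<in> {1..n}" for v w
    unfolding R_def using Pc(1) Pc'(1) that by (intro mult_four_block_diag) auto
  have wt: "weighted_trace (d + d') \<epsilon> (four_block_mat A (0\<^sub>m d d') (0\<^sub>m d' d) B)
    = of_real l * weighted_trace d \<delta> A + of_real (1 - l) * weighted_trace d' \<delta>' B"
    if "A \<in> carrier_mat d d" "B \<in> carrier_mat d' d'" for A B
    unfolding weighted_trace_def sum_lessThan_add sum_distrib_left using that
    by (intro arg_cong2[of _ _ _ _ "(+)"] sum.cong) (auto simp: \<epsilon>_def)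
  have "projection (d + d') (R v)" if v: "v \<in> {1..n}" for v
  proof -
    have "mat_adjoint (R v) = R v"
      unfolding R_def mat_adjoint_four_block[OF Pc(1)[OF v] Pc'(1)[OF v]] Pc(3)[OF v] Pc'(3)[OF v] ..
    moreover have "R v * R v = R v"
      using RR[OF v v] Pc(2)[OF v] Pc'(2)[OF v] by (simp add: R_def)
    ultimately show ?thesis
      using four_block_carrier_mat[OF Pc(1)[OF v] Pc'(1)[OF v]] by (simp add: projection_def R_def)
  qed
  moreover have "R v $$ (i, j) = 0" if "v \<in> {1..n}" "i < d + d'" "j < d + d'" "\<epsilon> i \<noteq> \<epsilon> j" for v i j
    using that Pc(1)[OF that(1)] Pc'(1)[OF that(1)] comm[OF that(1), of i j] comm'[OF that(1), of "i - d" "j - d"]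
    by (auto simp: R_def \<epsilon>_def split: if_splits)
  moreover have "0 \<le> \<epsilon> i" if "i < d + d'" for i
    using that \<delta>(1)[of i] \<delta>'(1)[of "i - d"] l by (auto simp: \<epsilon>_def)
  moreover have "(\<Sum>i<d + d'. \<epsilon> i) = 1"
  proof -
    have "(\<Sum>i<d + d'. \<epsilon> i) = (\<Sum>i<d. l * \<delta> i) + (\<Sum>i<d'. (1 - l) * \<delta>' i)"
      unfolding sum_lessThan_add by (intro arg_cong2[of _ _ _ _ "(+)"] sum.cong) (auto simp: \<epsilon>_def)
    thus ?thesis using \<delta>(2) \<delta>'(2) by (simp flip: sum_distrib_left)
  qed
  moreover have "complex_of_real (l * c v w + (1 - l) * c' v w) = weighted_trace (d + d') \<epsilon> (R v * R w)"
    if vw: "v \<in> {1..n}" "w \<in> {1..n}" for v w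
    unfolding RR[OF vw] using wt[of "P v * P w" "P' v * P' w"] Pc(1) Pc'(1) vw c[OF vw] c'[OF vw] by simp
  ultimately show ?thesis unfolding tracial_def by blast
qed

lemma tracial_convex_combination:
  assumes "finite S" "\<And>s. s \<in> S \<Longrightarrow> 0 \<le> u s" "sum u S = 1" "\<And>s. s \<in> S \<Longrightarrow> tracial n (C s)"
  shows "tracial n (\<lambda>v w. \<Sum>s\<in>S. u s * C s v w)"
  using assms
proof (induction S arbitrary: u rule: finite_induct)
  case (insert s S)
  show ?case
  proof (cases "sum u S = 0")
    \<comment> \<open>The weights on \<open>S\<close> cannot be renormalised to sum 1; they all
      vanish and only \<open>s\<close> contributes.\<close>
    case True
    hence "\<forall>x\<in>S. u x = 0" using insert by (subst (asm) sum_nonneg_eq_0_iff) auto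
    moreover from True have "u s = 1" using insert by simp
    ultimately have "(\<lambda>v w. \<Sum>x\<in>insert s S. u x * C x v w) = C s"
      using insert.hyps by (intro ext) (auto intro!: sum.neutral)
    thus ?thesis using insert.prems by simp
  next
    case False
    have us: "u s = 1 - sum u S" using insert by simp
    have pos: "sum u S \<ge> 0" using insert.prems(1) by (intro sum_nonneg) auto
    have "tracial n (\<lambda>v w. \<Sum>x\<in>S. (u x / sum u S) * C x v w)"
      using insert.prems False pos by (intro insert.IH) (auto simp flip: sum_divide_distrib)
    from tracial_mix[OF insert.prems(3)[of s] this, of "u s"] insert.prems(1)[of s] us pos
    have "tracial n (\<lambda>v w. u s * C s v w + sum u S * (\<Sum>x\<in>S. (u x / sum u S) * C x v w))" by simp
    moreover have "(\<lambda>v w. u s * C s v w + sum u S * (\<Sum>x\<in>S. (u x / sum u S) * C x v w))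
      = (\<lambda>v w. \<Sum>x\<in>insert s S. u x * C x v w)"
      using insert.hyps False by (intro ext) (simp add: sum_distrib_left)
    ultimately show ?thesis by simp
  qed
qed auto

lemma tracial_relabel:
  assumes "tracial n c" "\<And>v. v \<in> {1..n} \<Longrightarrow> \<pi> v \<in> {1..n}"
  shows "tracial n (\<lambda>v w. c (\<pi> v) (\<pi> w))"
proof -
  obtain d P \<delta> where "\<forall>v\<in>{1..n}. projection d (P v) \<and> (\<forall>i<d. \<forall>j<d. \<delta> i \<noteq> \<delta> j \<longrightarrow> P v $$ (i, j) = 0)"
     "(\<forall>i<d. 0 \<le> \<delta> i) \<and> (\<Sum>i<d. \<delta> i) = 1"
     "\<forall>v\<in>{1..n}. \<forall>w\<in>{1..n}. complex_of_real (c v w) = weighted_trace d \<delta> (P v * P w)"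
    using assms(1) unfolding tracial_def by blast
  thus ?thesis unfolding tracial_def using assms(2)
    by (intro exI[of _ d] exI[of _ "\<lambda>v. P (\<pi> v)"] exI[of _ \<delta>]) blast
qed

text \<open>Both parties read one shared coin of bias \<open>t\<close> and answer alike whatever the
  question. This shows that the infimum defining \<open>f_q\<close> is over a nonempty set.\<close>

lemma tracial_const:
  assumes "0 \<le> t" "t \<le> 1"
  shows "tracial n (\<lambda>v w. t)"
proof -
  define \<delta> where "\<delta> i = (if i = (0::nat) then t else 1 - t)" for i
  define P where "P = real_diag 2 (\<lambda>i. if i = 0 then 1 else 0)"
  have Pc: "P \<in> carrier_mat 2 2" by (simp add: P_def)
  have PP: "P * P = P"
  proof (rule eq_matI)
    fix i j assume "i < dim_row P" "j < dim_col P"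
    hence ij: "i < 2" "j < 2" using Pc by auto
    show "(P * P) $$ (i, j) = P $$ (i, j)"
      using mult_real_diag_index[OF Pc ij] ij by (auto simp: P_def real_diag_def simp del: index_mult_mat(1))
  qed (use Pc in auto)
  have "projection 2 P" using Pc PP by (simp add: projection_def P_def)
  moreover have "weighted_trace 2 \<delta> (P * P) = of_real t"
    unfolding PP by (simp add: weighted_trace_def P_def real_diag_def \<delta>_def lessThan_nat_numeral lessThan_Suc numeral_2_eq_2)
  moreover have "(\<Sum>i<2. \<delta> i) = 1" by (simp add: \<delta>_def numeral_2_eq_2)
  moreover have "0 \<le> \<delta> i" for i using assms by (simp add: \<delta>_def)
  moreover have "P $$ (i, j) = 0" if "i < 2" "j < 2" "\<delta> i \<noteq> \<delta> j" for i j
    using that by (cases "i = j") (auto simp: P_def real_diag_def)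
  ultimately show ?thesis unfolding tracial_def
    by (intro exI[of _ 2] exI[of _ "\<lambda>_. P"] exI[of _ \<delta>]) auto
qed

section \<open>Bounds and integrality for traces of projections\<close>

lemma hermitian_index:
  assumes "A \<in> carrier_mat d d" "mat_adjoint A = (A :: complex mat)" "i < d" "j < d"
  shows "A $$ (i, j) = cnj (A $$ (j, i))"
proof -
  have "A $$ (i, j) = mat_adjoint A $$ (i, j)" using assms(2) by simp
  also have "\<dots> = cnj (A $$ (j, i))" using assms(1,3,4) by simp
  finally show ?thesis .
qed

text \<open>Since P is P times its adjoint, a diagonal entry x is the squared norm of its row. The
  term \<open>l = i\<close> of that sum is x squared, so x squared is at most x.\<close>

lemma projection_diagonal:
  assumes P: "projection d P" and i: "i < d"
  shows "P $$ (i, i) = of_real (\<Sum>l<d. (cmod (P $$ (i, l)))\<^sup>2)"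
    and "(\<Sum>l<d. (cmod (P $$ (i, l)))\<^sup>2) \<le> 1"
proof -
  note P' = projectionD[OF P]
  let ?x = "\<Sum>l<d. (cmod (P $$ (i, l)))\<^sup>2"
  have "P $$ (i, i) = (P * P) $$ (i, i)" using P' by simp
  also have "\<dots> = (\<Sum>l<d. P $$ (i, l) * P $$ (l, i))" using mat_mult_index[OF P'(1,1) i i] .
  also have "\<dots> = (\<Sum>l<d. of_real ((cmod (P $$ (i, l)))\<^sup>2))"
    using hermitian_index[OF P'(1,3) _ i] i by (intro sum.cong) (auto simp: complex_norm_square simp del: of_real_power)
  finally show *: "P $$ (i, i) = of_real ?x" by simp
  have x0: "?x \<ge> 0" by (intro sum_nonneg) auto
  have "?x\<^sup>2 = (cmod (P $$ (i, i)))\<^sup>2" by (simp only: * norm_of_real power2_abs)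
  also have "\<dots> \<le> ?x" using i by (intro member_le_sum) auto
  finally show "?x \<le> 1" using x0 by (metis linorder_not_less mult_le_cancel_left2 order_le_less power2_eq_square not_one_le_zero)
qed

text \<open>The diagonal values are weighted means of diagonal entries of projections. The crude
  lower bound on \<open>c v w\<close> serves to make the infimum bounded below.\<close>

lemma tracial_bounds:
  assumes "tracial n c" "v \<in> {1..n}" "w \<in> {1..n}"
  shows "0 \<le> c v v" "c v v \<le> 1" "- 1 \<le> c v w"
proof -
  obtain d P \<delta> where P: "\<And>v. v \<in> {1..n} \<Longrightarrow> projection d (P v)"
    and \<delta>: "\<And>i. i < d \<Longrightarrow> 0 \<le> \<delta> i" "(\<Sum>i<d. \<delta> i) = 1"
    and c: "\<And>v w. v \<in> {1..n} \<Longrightarrow> w \<in> {1..n} \<Longrightarrow> complex_of_real (c v w) = weighted_trace d \<delta> (P v * P w)"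
    using assms(1) unfolding tracial_def by metis
  define x where "x v i = (\<Sum>l<d. (cmod (P v $$ (i, l)))\<^sup>2)" for v i
  have x: "P v $$ (i, i) = of_real (x v i)" "x v i \<le> 1" "0 \<le> x v i" if "v \<in> {1..n}" "i < d" for v i
    using projection_diagonal[OF P[OF that(1)] that(2)] by (auto simp: x_def intro: sum_nonneg)
  have cv: "c v v = (\<Sum>i<d. \<delta> i * x v i)" if v: "v \<in> {1..n}" for v
  proof -
    have "complex_of_real (c v v) = of_real (\<Sum>i<d. \<delta> i * x v i)"
      using c[OF v v] projectionD(2)[OF P[OF v]] x(1)[OF v] by (simp add: weighted_trace_def)
    thus ?thesis by (rule of_real_eq_iff[THEN iffD1])
  qed
  have b: "0 \<le> c v v" "c v v \<le> 1" if v: "v \<in> {1..n}" for v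
  proof -
    show "0 \<le> c v v" unfolding cv[OF v] using \<delta>(1) x(3)[OF v] by (intro sum_nonneg) auto
    have "(\<Sum>i<d. \<delta> i * x v i) \<le> (\<Sum>i<d. \<delta> i)"
      using \<delta>(1) x(2)[OF v] by (intro sum_mono mult_left_le) auto
    thus "c v v \<le> 1" using cv[OF v] \<delta>(2) by simp
  qed
  show "0 \<le> c v v" "c v v \<le> 1" using b assms(2) by auto
  note A = projectionD[OF P[OF assms(2)]] and B = projectionD[OF P[OF assms(3)]]
  have "c v w = Re (weighted_trace d \<delta> (P v * P w))" using c[OF assms(2,3)] by (metis Re_complex_of_real)
  also have "\<dots> = (\<Sum>i<d. \<delta> i * Re ((P v * P w) $$ (i, i)))" by (simp add: weighted_trace_def)
  also have "\<dots> \<ge> (\<Sum>i<d. \<delta> i * (- (x v i + x w i) / 2))"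
  proof (intro sum_mono mult_left_mono)
    fix i assume "i \<in> {..<d}"
    hence i: "i < d" by simp
    \<comment> \<open>Expanding the squared norm of the sum of the two \<open>i\<close>-th rows;
      since \<open>P w\<close> is Hermitian, the cross terms add up to the diagonal entry of
      \<open>P v * P w\<close>.\<close>
    have "0 \<le> (\<Sum>l<d. (cmod (P v $$ (i, l) + P w $$ (i, l)))\<^sup>2)" by (intro sum_nonneg) auto
    also have "\<dots> = (\<Sum>l<d. (cmod (P v $$ (i, l)))\<^sup>2 + (cmod (P w $$ (i, l)))\<^sup>2 + 2 * Re (P v $$ (i, l) * P w $$ (l, i)))"
      using hermitian_index[OF B(1,3) _ i]
      by (intro sum.cong) (auto simp: cmod_power2 power2_sum algebra_simps)
    also have "\<dots> = x v i + x w i + 2 * Re ((P v * P w) $$ (i, i))"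
      unfolding mat_mult_index[OF A(1) B(1) i i] x_def by (simp add: sum.distrib sum_distrib_left)
    finally show "- (x v i + x w i) / 2 \<le> Re ((P v * P w) $$ (i, i))" by simp
  qed (use \<delta> in auto)
  also have "(\<Sum>i<d. \<delta> i * (- (x v i + x w i) / 2)) =
      (\<Sum>i<d. (- 1 / 2) * (\<delta> i * x v i) + (- 1 / 2) * (\<delta> i * x w i))"
    by (intro sum.cong) (auto simp: field_simps)
  also have "\<dots> = (- 1 / 2) * c v v + (- 1 / 2) * c w w"
    unfolding cv[OF assms(2)] cv[OF assms(3)] by (simp only: sum.distrib sum_distrib_left)
  finally show "- 1 \<le> c v w" using b(2)[OF assms(2)] b(2)[OF assms(3)] by simp
qed

text \<open>Unitary conjugation preserves trace and idempotence, and an idempotent diagonal matrix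
  has entries 0 and 1. The number m is the rank, from which all rationality comes.\<close>

lemma mtrace_projection_nat:
  assumes "projection d P"
  shows "\<exists>m. mtrace P = of_nat m"
proof -
  note P = projectionD[OF assms]
  obtain U D where U: "U \<in> carrier_mat d d" "D \<in> carrier_mat d d" "mat_adjoint U * U = 1\<^sub>m d"
    "U * mat_adjoint U = 1\<^sub>m d" "diagonal_mat D" "P = U * D * mat_adjoint U"
    using hermitian_diagonalisation[OF P(1,3)] by blast
  let ?V = "mat_adjoint U"
  note as = assoc_mult_mat[of _ d d _ d _ d]
  have V: "?V \<in> carrier_mat d d" using U by simp
  have canc: "U * (?V * X) = X" "?V * (U * X) = X" if "X \<in> carrier_mat d d" for X
    using U V that assoc_mult_mat[OF U(1) V that] assoc_mult_mat[OF V U(1) that] by simp_all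
  have D: "D = ?V * P * U" unfolding U(6) using U V by (simp add: as canc)
  have "D * D = ?V * (P * P) * U" unfolding D using P(1) U(1) V by (simp add: as canc)
  hence DD: "D * D = D" using P(2) D by simp
  have dd: "D $$ (i, i) = 0 \<or> D $$ (i, i) = 1" if i: "i < d" for i
  proof -
    have "D $$ (i, i) = (\<Sum>l<d. D $$ (i, l) * D $$ (l, i))"
      using mat_mult_index[OF U(2,2) i i] DD by simp
    also have "\<dots> = (\<Sum>l<d. if l = i then D $$ (i, i) * D $$ (i, i) else 0)"
      using U(2,5) i by (intro sum.cong) (auto simp: diagonal_mat_def)
    finally show ?thesis using i by simp
  qed
  have "mtrace P = mtrace D"
    unfolding D using mtrace_comm[OF V, of "P * U"] P(1) U V by (simp add: as canc)
  also have "\<dots> = (\<Sum>i<d. of_nat (if D $$ (i, i) = 1 then 1 else 0))"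
    unfolding mtrace_def using U(2) dd by (intro sum.cong) auto
  finally show ?thesis by (metis of_nat_sum)
qed

text \<open>P is block diagonal along the level sets of \<open>\<delta>\<close>, so its compression
  \<open>M\<close> to one of them is again a projection: in \<open>M * M\<close> the summation
  indices outside the level set contribute nothing anyway.\<close>

lemma mtrace_projection_level_set_nat:
  fixes \<delta> :: "nat \<Rightarrow> real"
  assumes P: "projection d P"
    and comm: "\<And>i j. i < d \<Longrightarrow> j < d \<Longrightarrow> \<delta> i \<noteq> \<delta> j \<Longrightarrow> P $$ (i, j) = 0"
  shows "\<exists>m. (\<Sum>i | i < d \<and> \<delta> i = k. P $$ (i, i)) = of_nat m"
proof -
  note P' = projectionD[OF P]
  define M where "M = mat d d (\<lambda>(i, j). if \<delta> i = k \<and> \<delta> j = k then P $$ (i, j) else 0)"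
  have Mc: "M \<in> carrier_mat d d" by (simp add: M_def)
  have "M * M = M"
  proof (rule eq_matI)
    fix i j assume "i < dim_row M" "j < dim_col M"
    hence ij: "i < d" "j < d" by (auto simp: M_def)
    have "(M * M) $$ (i, j) = (\<Sum>l<d. M $$ (i, l) * M $$ (l, j))" by (rule mat_mult_index[OF Mc Mc ij])
    also have "\<dots> = (\<Sum>l<d. if \<delta> i = k \<and> \<delta> j = k then P $$ (i, l) * P $$ (l, j) else 0)"
      using ij comm by (intro sum.cong) (auto simp: M_def)
    also have "\<dots> = (if \<delta> i = k \<and> \<delta> j = k then (P * P) $$ (i, j) else 0)"
      using mat_mult_index[OF P'(1,1) ij] by auto
    finally show "(M * M) $$ (i, j) = M $$ (i, j)" using ij P'(2) by (simp add: M_def)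
  qed (auto simp: M_def)
  moreover have "mat_adjoint M = M"
  proof (rule eq_matI)
    fix i j assume "i < dim_row M" "j < dim_col M"
    hence ij: "i < d" "j < d" by (auto simp: M_def)
    show "mat_adjoint M $$ (i, j) = M $$ (i, j)"
      using ij hermitian_index[OF P'(1,3) ij] by (simp add: M_def)
  qed (auto simp: M_def)
  ultimately have M: "projection d M" using Mc by (simp add: projection_def)
  have "mtrace M = (\<Sum>i<d. if \<delta> i = k then P $$ (i, i) else 0)"
    unfolding mtrace_def by (auto simp: M_def intro!: sum.cong)
  also have "\<dots> = (\<Sum>i\<in>{..<d} \<inter> {i. \<delta> i = k}. P $$ (i, i))" by (simp add: sum.inter_restrict)
  also have "{..<d} \<inter> {i. \<delta> i = k} = {i. i < d \<and> \<delta> i = k}" by auto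
  finally show ?thesis using mtrace_projection_nat[OF M] by metis
qed

text \<open>Conjugation reverses the factors of Tr(A B \<rho>) to Tr(\<rho> B A), which equals Tr(A
  B \<rho>) because B commutes with \<rho>. In coordinates, the weight passes from \<open>i\<close>
  to \<open>l\<close> wherever \<open>B $$ (i, l)\<close> is nonzero. It allows real parts to be
  taken without loss.\<close>

lemma weighted_trace_mult_real:
  assumes A: "A \<in> carrier_mat d d" "mat_adjoint A = A" and B: "B \<in> carrier_mat d d" "mat_adjoint B = B"
    and comm: "\<And>i j. i < d \<Longrightarrow> j < d \<Longrightarrow> \<delta> i \<noteq> \<delta> j \<Longrightarrow> B $$ (i, j) = 0"
  shows "complex_of_real (Re (weighted_trace d \<delta> (A * B))) = weighted_trace d \<delta> (A * B)"
proof -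
  have wt: "weighted_trace d \<delta> (A * B) = (\<Sum>i<d. \<Sum>l<d. of_real (\<delta> i) * (A $$ (i, l) * B $$ (l, i)))"
    unfolding weighted_trace_def using mat_mult_index[OF A(1) B(1)] by (simp add: sum_distrib_left)
  have "cnj (weighted_trace d \<delta> (A * B)) = (\<Sum>i<d. \<Sum>l<d. of_real (\<delta> i) * (A $$ (l, i) * B $$ (i, l)))"
    unfolding wt cnj_sum using hermitian_index[OF A] hermitian_index[OF B]
    by (intro sum.cong refl) (metis (no_types, lifting) complex_cnj_complex_of_real complex_cnj_mult lessThan_iff)
  also have "\<dots> = (\<Sum>i<d. \<Sum>l<d. of_real (\<delta> l) * (A $$ (l, i) * B $$ (i, l)))"
    using comm by (intro sum.cong refl) (metis lessThan_iff mult_zero_right)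
  also have "\<dots> = weighted_trace d \<delta> (A * B)" unfolding wt by (rule sum.swap)
  finally show ?thesis by (metis Reals_cnj_iff complex_is_Real_iff complex.exhaust_sel complex_of_real_def)
qed

text \<open>The level sets of \<open>\<delta>\<close> index the eigenspaces of the density matrix; on each of them the
  correlation is a normalised trace, so its marginals are quotients of ranks.\<close>

lemma tracial_decomposition:
  assumes "tracial n c"
  shows "\<exists>(K :: real set) u C. finite K \<and> sum u K = 1 \<and>
    (\<forall>k\<in>K. 0 < u k \<and> tracial n (C k) \<and> (\<forall>v\<in>{1..n}. C k v v \<in> \<rat>)) \<and>
    (\<forall>v\<in>{1..n}. \<forall>w\<in>{1..n}. c v w = (\<Sum>k\<in>K. u k * C k v w))"
proof -
  obtain d P \<delta> where P: "\<And>v. v \<in> {1..n} \<Longrightarrow> projection d (P v)"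
    and comm: "\<And>v i j. v \<in> {1..n} \<Longrightarrow> i < d \<Longrightarrow> j < d \<Longrightarrow> \<delta> i \<noteq> \<delta> j \<Longrightarrow> P v $$ (i, j) = 0"
    and \<delta>: "\<And>i. i < d \<Longrightarrow> 0 \<le> \<delta> i" "(\<Sum>i<d. \<delta> i) = 1"
    and c: "\<And>v w. v \<in> {1..n} \<Longrightarrow> w \<in> {1..n} \<Longrightarrow> complex_of_real (c v w) = weighted_trace d \<delta> (P v * P w)"
    using assms unfolding tracial_def by metis
  note Pc = projectionD[OF P]
  \<comment> \<open>Eigenvalue 0 is left out so that all weights \<open>u k\<close> are positive.
    The weight of an eigenvalue is its total mass, and \<open>\<epsilon> k\<close> is the uniform
    distribution on its level set.\<close>
  define K where "K = \<delta> ` {..<d} - {0}"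
  define I where "I k = {i. i < d \<and> \<delta> i = k}" for k
  define u where "u k = k * real (card (I k))" for k
  define \<epsilon> where "\<epsilon> k i = (if \<delta> i = k then 1 / real (card (I k)) else 0)" for k i
  define C where "C k v w = Re (weighted_trace d (\<epsilon> k) (P v * P w))" for k v w
  have finI: "finite (I k)" for k by (simp add: I_def)
  have finK: "finite K" by (simp add: K_def)
  have Ipos: "card (I k) > 0" "k > 0" if "k \<in> K" for k
    using that \<delta>(1) finI by (auto simp: K_def I_def card_gt_0_iff order.strict_iff_order)
  have level: "(\<Sum>i<d. of_real (\<epsilon> k i) * g i) = (\<Sum>i\<in>I k. g i) / of_nat (card (I k))" for k and g :: "nat \<Rightarrow> complex"
  proof -
    have "(\<Sum>i<d. of_real (\<epsilon> k i) * g i) = (\<Sum>i\<in>I k. of_real (\<epsilon> k i) * g i)"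
      by (rule sum.mono_neutral_right) (auto simp: I_def \<epsilon>_def)
    also have "\<dots> = (\<Sum>i\<in>I k. g i / of_nat (card (I k)))"
      by (intro sum.cong) (auto simp: I_def \<epsilon>_def)
    finally show ?thesis by (simp add: sum_divide_distrib)
  qed
  have split: "(\<Sum>i<d. of_real (\<delta> i) * g i) = (\<Sum>k\<in>K. of_real (u k) * (\<Sum>i<d. of_real (\<epsilon> k i) * g i))" for g :: "nat \<Rightarrow> complex"
  proof -
    have "(\<Sum>k\<in>K. of_real (u k) * (\<Sum>i<d. of_real (\<epsilon> k i) * g i)) = (\<Sum>k\<in>K. \<Sum>i\<in>I k. of_real (\<delta> i) * g i)"
    proof (rule sum.cong[OF refl])
      fix k assume k: "k \<in> K"
      have "of_real (u k) * (\<Sum>i<d. of_real (\<epsilon> k i) * g i) = of_real k * (\<Sum>i\<in>I k. g i)"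
        unfolding level u_def using Ipos[OF k] by simp
      also have "\<dots> = (\<Sum>i\<in>I k. of_real (\<delta> i) * g i)"
        unfolding sum_distrib_left by (intro sum.cong) (auto simp: I_def)
      finally show "of_real (u k) * (\<Sum>i<d. of_real (\<epsilon> k i) * g i) = (\<Sum>i\<in>I k. of_real (\<delta> i) * g i)" .
    qed
    also have "\<dots> = (\<Sum>i\<in>(\<Union>k\<in>K. I k). of_real (\<delta> i) * g i)"
      using finK finI by (subst sum.UNION_disjoint) (auto simp: I_def)
    also have "\<dots> = (\<Sum>i<d. of_real (\<delta> i) * g i)"
      by (rule sum.mono_neutral_left) (auto simp: I_def K_def)
    finally show ?thesis ..
  qed
  have \<epsilon>1: "(\<Sum>i<d. \<epsilon> k i) = 1" if "k \<in> K" for k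
  proof -
    have "complex_of_real (\<Sum>i<d. \<epsilon> k i) = 1" using level[of k "\<lambda>_. 1"] Ipos[OF that] by simp
    thus ?thesis by (metis of_real_eq_1_iff)
  qed
  have real: "complex_of_real (C k v w) = weighted_trace d (\<epsilon> k) (P v * P w)"
    if vw: "v \<in> {1..n}" "w \<in> {1..n}" for k v w
    unfolding C_def using Pc(1,3) comm vw
    by (intro weighted_trace_mult_real) (auto simp: \<epsilon>_def split: if_splits)
  have "tracial n (C k)" if k: "k \<in> K" for k
  proof -
    \<comment> \<open>\<open>\<epsilon> k\<close> is a function of \<open>\<delta>\<close>, so the
      same projections stay admissible for the new weights.\<close>
    have "\<epsilon> k i \<noteq> \<epsilon> k j \<Longrightarrow> \<delta> i \<noteq> \<delta> j" for i j by (auto simp: \<epsilon>_def)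
    thus ?thesis unfolding tracial_def using P comm \<epsilon>1[OF k] real
      by (intro exI[of _ d] exI[of _ P] exI[of _ "\<epsilon> k"]) (auto simp: \<epsilon>_def)
  qed
  moreover have "C k v v \<in> \<rat>" if v: "v \<in> {1..n}" for k v
  proof -
    obtain m where m: "(\<Sum>i\<in>I k. P v $$ (i, i)) = of_nat m"
      using mtrace_projection_level_set_nat[OF P[OF v] comm[OF v], where k = k] unfolding I_def by blast
    have "weighted_trace d (\<epsilon> k) (P v * P v) = of_nat m / of_nat (card (I k))"
      unfolding Pc(2)[OF v] weighted_trace_def level m ..
    hence "complex_of_real (C k v v) = of_real (real m / real (card (I k)))"
      using real[OF v v] by simp
    hence "C k v v = real m / real (card (I k))" by (rule of_real_eq_iff[THEN iffD1])
    thus ?thesis by simp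
  qed
  moreover have "c v w = (\<Sum>k\<in>K. u k * C k v w)" if vw: "v \<in> {1..n}" "w \<in> {1..n}" for v w
  proof -
    have "complex_of_real (c v w) = of_real (\<Sum>k\<in>K. u k * C k v w)"
      using split[of "\<lambda>i. (P v * P w) $$ (i, i)"] c[OF vw] real[OF vw] by (simp add: weighted_trace_def)
    thus ?thesis by (rule of_real_eq_iff[THEN iffD1])
  qed
  moreover have "sum u K = 1"
  proof -
    have "complex_of_real (sum u K) = (\<Sum>k\<in>K. of_real (u k) * (\<Sum>i<d. of_real (\<epsilon> k i) * 1))"
      using \<epsilon>1 by (simp flip: of_real_sum)
    also have "\<dots> = of_real (\<Sum>i<d. \<delta> i)" using split[of "\<lambda>_. 1"] by simp
    finally show ?thesis using \<delta>(2) by (metis of_real_eq_iff)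
  qed
  moreover have "0 < u k" if "k \<in> K" for k using Ipos[OF that] by (simp add: u_def)
  ultimately show ?thesis using finK by blast
qed

subsection \<open>Averages over automorphisms and convexity\<close>

text \<open>Extensionality leaves one representative per permutation of the vertices, so the set is
  finite and can be averaged over.\<close>

definition automorphisms :: "nat \<Rightarrow> (nat \<times> nat) set \<Rightarrow> (nat \<Rightarrow> nat) set" where
  "automorphisms n E = {\<pi> \<in> extensional {1..n}. graph_automorphism n E \<pi>}"

lemma finite_automorphisms: "finite (automorphisms n E)"
proof (rule finite_subset)
  show "automorphisms n E \<subseteq> {1..n} \<rightarrow>\<^sub>E {1..n}"
    by (auto simp: automorphisms_def graph_automorphism_def PiE_def dest: bij_betwE)
qed (simp add: finite_PiE)

lemma automorphism_in_range:
  "graph_automorphism n E \<pi> \<Longrightarrow> v \<in> {1..n} \<Longrightarrow> \<pi> v \<in> {1..n}"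
  by (auto simp: graph_automorphism_def dest: bij_betwE)

lemma compose_automorphism:
  assumes "graph_automorphism n E \<pi>" "graph_automorphism n E \<sigma>"
  shows "compose {1..n} \<pi> \<sigma> \<in> automorphisms n E"
proof -
  have "bij_betw (compose {1..n} \<pi> \<sigma>) {1..n} {1..n}"
    using assms bij_betw_compose unfolding graph_automorphism_def by blast
  moreover have "(v, w) \<in> E \<longleftrightarrow> (compose {1..n} \<pi> \<sigma> v, compose {1..n} \<pi> \<sigma> w) \<in> E"
    if vw: "v \<in> {1..n}" "w \<in> {1..n}" for v w
  proof -
    have "(v, w) \<in> E \<longleftrightarrow> (\<sigma> v, \<sigma> w) \<in> E"
      using assms(2) vw unfolding graph_automorphism_def by blast
    also have "\<dots> \<longleftrightarrow> (\<pi> (\<sigma> v), \<pi> (\<sigma> w)) \<in> E"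
      using assms(1) automorphism_in_range[OF assms(2)] vw unfolding graph_automorphism_def by blast
    finally show ?thesis using vw by (simp add: compose_def)
  qed
  ultimately show ?thesis by (simp add: automorphisms_def graph_automorphism_def)
qed

lemma automorphisms_nonempty: "automorphisms n E \<noteq> {}"
proof -
  have "graph_automorphism n E id" by (simp add: graph_automorphism_def)
  from compose_automorphism[OF this this] show ?thesis by blast
qed

lemma sum_automorphism_edges:
  fixes g :: "nat \<Rightarrow> nat \<Rightarrow> 'a :: comm_monoid_add"
  assumes E: "E \<subseteq> {1..n} \<times> {1..n}" and \<pi>: "graph_automorphism n E \<pi>"
  shows "(\<Sum>(v, w)\<in>E. g (\<pi> v) (\<pi> w)) = (\<Sum>(v, w)\<in>E. g v w)"
proof -
  have bij: "bij_betw \<pi> {1..n} {1..n}"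
    and pres: "\<And>v w. v \<in> {1..n} \<Longrightarrow> w \<in> {1..n} \<Longrightarrow> (v, w) \<in> E \<longleftrightarrow> (\<pi> v, \<pi> w) \<in> E"
    using \<pi> unfolding graph_automorphism_def by blast+
  have fin: "finite E" using finite_subset[OF E] by simp
  let ?h = "\<lambda>(v, w). (\<pi> v, \<pi> w)"
  have inj: "inj_on ?h E"
    using bij_betw_imp_inj_on[OF bij] E by (auto simp: inj_on_def)
  have "?h ` E \<subseteq> E" using pres E by auto
  hence img: "?h ` E = E" using endo_inj_surj[OF fin _ inj] by blast
  have "(\<Sum>(v, w)\<in>E. g v w) = (\<Sum>(v, w)\<in>?h ` E. g v w)" by (simp only: img)
  also have "\<dots> = (\<Sum>(v, w)\<in>E. g (\<pi> v) (\<pi> w))"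
    unfolding sum.reindex[OF inj] by (intro sum.cong) auto
  finally show ?thesis ..
qed

lemma sum_automorphism_vertices:
  fixes g :: "nat \<Rightarrow> 'a :: comm_monoid_add"
  assumes "graph_automorphism n E \<pi>"
  shows "(\<Sum>v=1..n. g (\<pi> v)) = (\<Sum>v=1..n. g v)"
  using assms sum.reindex_bij_betw unfolding graph_automorphism_def by blast

text \<open>Right composition with an automorphism taking \<open>v\<close> to \<open>w\<close>
  permutes the group: it is injective because that automorphism is onto the vertices, and then onto
  by finiteness.\<close>

lemma sum_over_automorphisms_const:
  fixes g :: "nat \<Rightarrow> 'a :: comm_monoid_add"
  assumes vt: "vertex_transitive n E" and v: "v \<in> {1..n}" and w: "w \<in> {1..n}"
  shows "(\<Sum>\<pi>\<in>automorphisms n E. g (\<pi> w)) = (\<Sum>\<pi>\<in>automorphisms n E. g (\<pi> v))"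
proof -
  obtain \<sigma> where \<sigma>: "graph_automorphism n E \<sigma>" "\<sigma> v = w"
    using vt v w unfolding vertex_transitive_def by blast
  let ?A = "automorphisms n E" and ?h = "\<lambda>\<pi>. compose {1..n} \<pi> \<sigma>"
  have sub: "?h ` ?A \<subseteq> ?A" using compose_automorphism[OF _ \<sigma>(1)] by (auto simp: automorphisms_def)
  have inj: "inj_on ?h ?A"
  proof (rule inj_onI)
    fix \<pi> \<tau> assume h: "\<pi> \<in> ?A" "\<tau> \<in> ?A" "?h \<pi> = ?h \<tau>"
    show "\<pi> = \<tau>"
    proof (rule extensionalityI[of _ "{1..n}"])
      fix y assume "y \<in> {1..n}"
      then obtain x where x: "x \<in> {1..n}" "y = \<sigma> x"
        using \<sigma>(1) unfolding graph_automorphism_def bij_betw_def by blast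
      from fun_cong[OF h(3), of x] x show "\<pi> y = \<tau> y" by (simp add: compose_def)
    qed (use h in \<open>auto simp: automorphisms_def\<close>)
  qed
  have img: "?h ` ?A = ?A" using endo_inj_surj[OF finite_automorphisms sub inj] .
  have "(\<Sum>\<pi>\<in>?A. g (\<pi> v)) = (\<Sum>\<pi>\<in>?h ` ?A. g (\<pi> v))" by (simp only: img)
  also have "\<dots> = (\<Sum>\<pi>\<in>?A. g (\<pi> w))"
    unfolding sum.reindex[OF inj] using v \<sigma>(2) by (simp add: compose_def)
  finally show ?thesis ..
qed

text \<open>The constant diagonal value is the mean of the old ones, so rational diagonals give a
  rational constant.\<close>

lemma tracial_average:
  assumes G: "simple_graph n E" and vt: "vertex_transitive n E" and c: "tracial n c"
  shows "\<exists>c'. tracial n c' \<and> (\<forall>v\<in>{1..n}. c' v v = (\<Sum>v=1..n. c v v) / real n) \<and>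
    (\<Sum>(v, w)\<in>E. c' v w) = (\<Sum>(v, w)\<in>E. c v w)"
proof -
  let ?A = "automorphisms n E"
  have n: "n \<ge> 1" and E: "E \<subseteq> {1..n} \<times> {1..n}" using G by (auto simp: simple_graph_def)
  have aut: "graph_automorphism n E \<pi>" if "\<pi> \<in> ?A" for \<pi> using that by (simp add: automorphisms_def)
  define N where "N = real (card ?A)"
  have N: "N > 0" using finite_automorphisms automorphisms_nonempty by (auto simp: N_def card_gt_0_iff)
  define c' where "c' = (\<lambda>v w. \<Sum>\<pi>\<in>?A. (1 / N) * c (\<pi> v) (\<pi> w))"
  have "tracial n c'"
    unfolding c'_def
  proof (rule tracial_convex_combination[OF finite_automorphisms])
    show "(\<Sum>\<pi>\<in>?A. 1 / N) = 1" using N by (simp add: N_def)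
    show "tracial n (\<lambda>v w. c (\<pi> v) (\<pi> w))" if "\<pi> \<in> ?A" for \<pi>
      using automorphism_in_range[OF aut[OF that]] by (intro tracial_relabel[OF c]) auto
  qed (use N in auto)
  moreover have "c' v v = (\<Sum>v=1..n. c v v) / real n" if v: "v \<in> {1..n}" for v
  proof -
    have "c' w w = c' v v" if "w \<in> {1..n}" for w
      unfolding c'_def sum_distrib_left[symmetric]
      using sum_over_automorphisms_const[OF vt v that, of "\<lambda>v. c v v"] by simp
    \<comment> \<open>The common value is identified by summing over all vertices, which every
      automorphism merely permutes.\<close>
    hence "real n * c' v v = (\<Sum>w=1..n. c' w w)" by simp
    also have "\<dots> = (\<Sum>\<pi>\<in>?A. (1 / N) * (\<Sum>w=1..n. c (\<pi> w) (\<pi> w)))"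
      unfolding c'_def sum_distrib_left by (rule sum.swap)
    also have "\<dots> = (\<Sum>\<pi>\<in>?A. (1 / N) * (\<Sum>w=1..n. c w w))"
      using sum_automorphism_vertices[OF aut, of _ "\<lambda>v. c v v"] by simp
    also have "\<dots> = (\<Sum>w=1..n. c w w)" using N by (simp add: N_def)
    finally show ?thesis using n by (simp add: field_simps)
  qed
  moreover have "(\<Sum>(v, w)\<in>E. c' v w) = (\<Sum>(v, w)\<in>E. c v w)"
  proof -
    have "(\<Sum>(v, w)\<in>E. c' v w) = (\<Sum>\<pi>\<in>?A. (1 / N) * (\<Sum>(v, w)\<in>E. c (\<pi> v) (\<pi> w)))"
      unfolding c'_def sum_distrib_left case_prod_unfold by (rule sum.swap)
    also have "\<dots> = (\<Sum>\<pi>\<in>?A. (1 / N) * (\<Sum>(v, w)\<in>E. c v w))"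
      using sum_automorphism_edges[OF E aut, of _ c] by simp
    also have "\<dots> = (\<Sum>(v, w)\<in>E. c v w)" using N by (simp add: N_def)
    finally show ?thesis .
  qed
  ultimately show ?thesis by blast
qed

section \<open>The value function as an infimum over tracial correlations\<close>

lemma Gamma_q_eq:
  assumes "n \<ge> 1"
  shows "Gamma_q n t = correlation n ` {c. tracial n c \<and> (\<forall>v\<in>{1..n}. c v v = t)}"
proof -
  have "C_q_s n = correlation n ` {c. tracial n c}"
    using C_q_s_imp_tracial tracial_imp_C_q_s by auto
  moreover have "marginal_A (correlation n c) 0 v w = c v v" "marginal_B (correlation n c) 0 v w = c w w"
    if "v \<in> {1..n}" "w \<in> {1..n}" for c v w
    using that by (auto simp: marginal_A_def marginal_B_def correlation_def indices_def)
  ultimately show ?thesis using assms by (auto simp: Gamma_q_def)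
qed

lemma edge_sum_correlation:
  assumes "E \<subseteq> {1..n} \<times> {1..n}"
  shows "edge_sum E (correlation n c) = (\<Sum>(v, w)\<in>E. c v w)"
  unfolding edge_sum_def using assms
  by (intro sum.cong) (auto simp: correlation_def indices_def)

lemma f_q_eq_Inf:
  assumes "simple_graph n E"
  shows "f_q n E t = (INF c\<in>{c. tracial n c \<and> (\<forall>v\<in>{1..n}. c v v = t)}. \<Sum>(v, w)\<in>E. c v w)"
  using assms by (simp add: f_q_def simple_graph_def Gamma_q_eq image_image edge_sum_correlation)

lemma f_q_le:
  assumes G: "simple_graph n E" and c: "tracial n c" "\<And>v. v \<in> {1..n} \<Longrightarrow> c v v = t"
  shows "f_q n E t \<le> (\<Sum>(v, w)\<in>E. c v w)"
proof -
  have "- real (card E) \<le> (\<Sum>(v, w)\<in>E. c v w)" if "tracial n c" for c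
  proof -
    have "(\<Sum>(v, w)\<in>E. c v w) \<ge> (\<Sum>e\<in>E. - 1)"
      using G tracial_bounds(3)[OF that] by (intro sum_mono) (auto simp: simple_graph_def)
    thus ?thesis by simp
  qed
  thus ?thesis unfolding f_q_eq_Inf[OF G] using c
    by (intro cINF_lower bdd_belowI2[of _ "- real (card E)"]) auto
qed

lemma f_q_greatest:
  assumes G: "simple_graph n E" and t: "0 \<le> t" "t \<le> 1"
    and "\<And>c. tracial n c \<Longrightarrow> (\<And>v. v \<in> {1..n} \<Longrightarrow> c v v = t) \<Longrightarrow> z \<le> (\<Sum>(v, w)\<in>E. c v w)"
  shows "z \<le> f_q n E t"
  unfolding f_q_eq_Inf[OF G] using tracial_const[OF t] assms(4) by (intro cINF_greatest) auto

text \<open>Minimisers at \<open>x\<close> and \<open>y\<close> need not exist, so the mixing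
  inequality is passed to the infimum twice: over \<open>c\<close> with \<open>c'\<close> fixed,
  then over \<open>c'\<close>. Each passage divides by a weight, hence the strict bounds on
  \<open>l\<close>.\<close>

lemma f_q_convex:
  assumes G: "simple_graph n E" and x: "x \<in> {0..1}" and y: "y \<in> {0..1}" and l: "0 < l" "l < 1"
  shows "f_q n E (l * x + (1 - l) * y) \<le> l * f_q n E x + (1 - l) * f_q n E y"
proof -
  let ?z = "f_q n E (l * x + (1 - l) * y)"
  have mix: "?z \<le> l * (\<Sum>(v, w)\<in>E. c v w) + (1 - l) * (\<Sum>(v, w)\<in>E. c' v w)"
    if "tracial n c" "\<And>v. v \<in> {1..n} \<Longrightarrow> c v v = x" "tracial n c'" "\<And>v. v \<in> {1..n} \<Longrightarrow> c' v v = y" for c c'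
  proof -
    have "?z \<le> (\<Sum>(v, w)\<in>E. l * c v w + (1 - l) * c' v w)"
      using that tracial_mix[of n c c' l] l by (intro f_q_le[OF G]) auto
    thus ?thesis by (simp add: sum.distrib sum_distrib_left case_prod_unfold)
  qed
  have "(?z - (1 - l) * (\<Sum>(v, w)\<in>E. c' v w)) / l \<le> f_q n E x"
    if "tracial n c'" "\<And>v. v \<in> {1..n} \<Longrightarrow> c' v v = y" for c'
    using mix[OF _ _ that] l x by (intro f_q_greatest[OF G]) (auto simp: field_simps)
  hence "(?z - l * f_q n E x) / (1 - l) \<le> (\<Sum>(v, w)\<in>E. c' v w)"
    if "tracial n c'" "\<And>v. v \<in> {1..n} \<Longrightarrow> c' v v = y" for c'
    using that l by (force simp: field_simps)
  hence "(?z - l * f_q n E x) / (1 - l) \<le> f_q n E y"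
    using y by (intro f_q_greatest[OF G]) auto
  thus ?thesis using l by (simp add: field_simps)
qed

section \<open>Convexity on the real line\<close>

lemma supporting_line:
  fixes g :: "real \<Rightarrow> real"
  assumes conv: "\<And>x y l. x \<in> {a..b} \<Longrightarrow> y \<in> {a..b} \<Longrightarrow> 0 < l \<Longrightarrow> l < 1 \<Longrightarrow>
      g (l * x + (1 - l) * y) \<le> l * g x + (1 - l) * g y"
    and t: "a < t" "t < b"
  shows "\<exists>m. \<forall>x\<in>{a..b}. g t + m * (x - t) \<le> g x"
proof -
  define S where "S x = (g t - g x) / (t - x)" for x
  have slopes: "S x \<le> (g y - g t) / (y - t)" if x: "a \<le> x" "x < t" and y: "t < y" "y \<le> b" for x y
  proof -
    \<comment> \<open>The weight for which \<open>t\<close> is the mixture of \<open>x\<close> and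
      \<open>y\<close>.\<close>
    define l where "l = (y - t) / (y - x)"
    have l: "0 < l" "l < 1" using x y by (auto simp: l_def field_simps)
    have l1: "1 - l = (t - x) / (y - x)" using x y by (simp add: l_def field_simps)
    have "l * x + (1 - l) * y = ((y - t) * x + (t - x) * y) / (y - x)"
      unfolding l1 by (simp add: l_def add_divide_distrib)
    also have "(y - t) * x + (t - x) * y = t * (y - x)" by (simp add: algebra_simps)
    finally have "l * x + (1 - l) * y = t" using x y by simp
    hence "g t \<le> l * g x + (1 - l) * g y" using conv[of x y l] x y l by auto
    also have "\<dots> = ((y - t) * g x + (t - x) * g y) / (y - x)"
      unfolding l1 by (simp add: l_def add_divide_distrib)
    finally have "g t * (y - x) \<le> (y - t) * g x + (t - x) * g y"
      using x y by (simp add: pos_le_divide_eq)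
    hence "(g t - g x) * (y - t) \<le> (g y - g t) * (t - x)" by (simp add: algebra_simps)
    thus ?thesis using x y by (simp add: S_def frac_le_eq divide_le_eq pos_le_divide_eq field_simps)
  qed
  \<comment> \<open>The left derivative at \<open>t\<close>, as a supremum of chord slopes. It is
    finite because every left slope is at most the slope of the chord to \<open>b\<close>, and for
    the same reason \<open>m\<close> is at most every right slope.\<close>
  define m where "m = (SUP x\<in>{a..<t}. S x)"
  have bdd: "bdd_above (S ` {a..<t})"
    using slopes[of _ b] t by (intro bdd_aboveI2) auto
  have "g t + m * (x - t) \<le> g x" if x: "x \<in> {a..b}" for x
  proof (cases x t rule: linorder_cases)
    case less
    hence "S x \<le> m" unfolding m_def using x by (intro cSUP_upper bdd) auto
    thus ?thesis using less by (simp add: S_def pos_divide_le_eq algebra_simps)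
  next
    case greater
    hence "m \<le> (g x - g t) / (x - t)"
      unfolding m_def using slopes x t by (intro cSUP_least) auto
    thus ?thesis using greater by (simp add: pos_le_divide_eq algebra_simps)
  qed simp
  thus ?thesis by blast
qed

text \<open>If all values lay above the mean, the weighted deviations would have a positive sum. The
  other side follows by negating \<open>r\<close> and \<open>t\<close>.\<close>

lemma convex_combination_straddles:
  fixes r u :: "'a \<Rightarrow> real"
  assumes "finite K" "sum u K = 1" "\<And>k. k \<in> K \<Longrightarrow> 0 < u k" "(\<Sum>k\<in>K. u k * r k) = t"
    and ne: "\<And>k. k \<in> K \<Longrightarrow> r k \<noteq> t"
  shows "\<exists>k\<in>K. r k < t"
proof (rule ccontr)
  assume "\<not> ?thesis"
  hence pos: "0 < u k * (r k - t)" if "k \<in> K" for k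
    using that ne[OF that] assms(3)[OF that] by (force simp: not_less order.strict_iff_order)
  have "K \<noteq> {}" using assms(2) by auto
  hence "0 < (\<Sum>k\<in>K. u k * (r k - t))" using assms(1) pos by (intro sum_pos) auto
  also have "\<dots> = (\<Sum>k\<in>K. u k * r k) - sum u K * t"
    by (simp add: right_diff_distrib sum_subtractf sum_distrib_right)
  finally show False using assms(2,4) by simp
qed

theorem proposition3p6:
  fixes n :: nat and E :: "(nat \<times> nat) set" and t :: real
  assumes "simple_graph n E"
    and "vertex_transitive n E"
    and "edge_transitive n E"
    and "t \<in> {0..1}"
    and "t \<notin> \<rat>"
    and "\<exists>p\<in>Gamma_q n t. edge_sum E p = f_q n E t"
  shows "\<exists>r s. r \<in> \<rat> \<and> s \<in> \<rat> \<and> r < s \<and> {r..s} \<subseteq> {0..1} \<and> t \<in> {r..s} \<and>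
           (\<exists>a b. \<forall>x\<in>{r..s}. f_q n E x = a * x + b)"
proof -
  note G = assms(1)
  let ?f = "f_q n E"
  have n: "n \<ge> 1" and E: "E \<subseteq> {1..n} \<times> {1..n}" using G by (auto simp: simple_graph_def)
  \<comment> \<open>The endpoints are rational, so \<open>t\<close> is interior and a supporting
    line exists there.\<close>
  have t: "0 < t" "t < 1" using assms(4,5) by (auto simp: order.strict_iff_order)
  obtain c where c: "tracial n c" "\<And>v. v \<in> {1..n} \<Longrightarrow> c v v = t" "(\<Sum>(v, w)\<in>E. c v w) = ?f t"
    using assms(6) by (auto simp: Gamma_q_eq[OF n] edge_sum_correlation[OF E])
  obtain K :: "real set" and u C where "finite K" "sum u K = 1"
    and uC: "\<forall>k\<in>K. 0 < u k \<and> tracial n (C k) \<and> (\<forall>v\<in>{1..n}. C k v v \<in> \<rat>)"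
    and cC: "\<forall>v\<in>{1..n}. \<forall>w\<in>{1..n}. c v w = (\<Sum>k\<in>K. u k * C k v w)"
    using tracial_decomposition[OF c(1)] by (elim exE conjE) (rule that)
  then have K: "finite K" "sum u K = 1" "\<And>k. k \<in> K \<Longrightarrow> 0 < u k"
    and C: "\<And>k. k \<in> K \<Longrightarrow> tracial n (C k)" "\<And>k v. k \<in> K \<Longrightarrow> v \<in> {1..n} \<Longrightarrow> C k v v \<in> \<rat>"
    by simp_all
  \<comment> \<open>The diagonal of \<open>C k\<close> may vary with the vertex; \<open>r k\<close>
    is its value after averaging, while the edge sum \<open>F k\<close> is unchanged by
    averaging.\<close>
  define r where "r k = (\<Sum>v=1..n. C k v v) / real n" for k
  define F where "F k = (\<Sum>(v, w)\<in>E. C k v w)" for k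
  have r: "r k \<in> \<rat>" "r k \<in> {0..1}" "?f (r k) \<le> F k" if k: "k \<in> K" for k
  proof -
    obtain c' where c': "tracial n c'" "\<And>v. v \<in> {1..n} \<Longrightarrow> c' v v = r k" "(\<Sum>(v, w)\<in>E. c' v w) = F k"
      using tracial_average[OF G assms(2) C(1)[OF k]] unfolding r_def F_def by blast
    show "r k \<in> \<rat>" unfolding r_def using C(2)[OF k] by (intro Rats_divide Rats_sum) auto
    show "r k \<in> {0..1}" using tracial_bounds(1,2)[OF c'(1), of 1] c'(2)[of 1] n by auto
    show "?f (r k) \<le> F k" using f_q_le[OF G c'(1,2)] c'(3) by simp
  qed
  have sr: "(\<Sum>k\<in>K. u k * r k) = t"
  proof -
    have "(\<Sum>k\<in>K. u k * r k) = (\<Sum>v=1..n. \<Sum>k\<in>K. u k * C k v v) / real n"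
      unfolding r_def by (subst sum.swap) (simp add: sum_divide_distrib sum_distrib_left)
    also have "(\<Sum>v=1..n. \<Sum>k\<in>K. u k * C k v v) = (\<Sum>v=1..n. t)"
      using cC c(2) by (intro sum.cong) auto
    finally show ?thesis using n by simp
  qed
  have sF: "(\<Sum>k\<in>K. u k * F k) = ?f t"
  proof -
    have "(\<Sum>k\<in>K. u k * F k) = (\<Sum>(v, w)\<in>E. \<Sum>k\<in>K. u k * C k v w)"
      unfolding F_def case_prod_unfold sum_distrib_left by (rule sum.swap)
    also have "\<dots> = (\<Sum>(v, w)\<in>E. c v w)"
      using cC E by (intro sum.cong) auto
    finally show ?thesis using c(3) by simp
  qed
  obtain m where m: "\<And>x. x \<in> {0..1} \<Longrightarrow> ?f t + m * (x - t) \<le> ?f x"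
    using supporting_line[OF f_q_convex[OF G] t] by blast
  have line: "?f (r k) = ?f t + m * (r k - t)" if k: "k \<in> K" for k
  proof -
    \<comment> \<open>The gap between \<open>F k\<close> and the line bounds the gap between
      \<open>?f (r k)\<close> and the line. The weighted gaps are nonnegative and sum to zero, since
      a line takes the same value at the mean as on average.\<close>
    have nonneg: "0 \<le> u k * (F k - (?f t + m * (r k - t)))" if "k \<in> K" for k
      using K(3)[OF that] r(3)[OF that] m[OF r(2)[OF that]] by simp
    have "(\<Sum>k\<in>K. u k * (F k - (?f t + m * (r k - t)))) =
      (\<Sum>k\<in>K. u k * F k) - ?f t * sum u K - m * ((\<Sum>k\<in>K. u k * r k) - t * sum u K)"
      by (simp add: sum_distrib_left sum_distrib_right sum_subtractf sum.distrib algebra_simps)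
    also have "\<dots> = 0" using sF sr K(2) by simp
    finally have "u k * (F k - (?f t + m * (r k - t))) = 0"
      using nonneg k sum_nonneg_0[OF K(1), of "\<lambda>k. u k * (F k - (?f t + m * (r k - t)))"] by blast
    thus ?thesis using K(3)[OF k] r(3)[OF k] m[OF r(2)[OF k]] by simp
  qed
  have ne: "r k \<noteq> t" if "k \<in> K" for k using r(1)[OF that] assms(5) by auto
  obtain i where i: "i \<in> K" "r i < t" using convex_combination_straddles[OF K sr ne] by blast
  \<comment> \<open>The mirrored statement provides a point to the right of
    \<open>t\<close>.\<close>
  have "\<exists>j\<in>K. - r j < - t"
    using ne sr by (intro convex_combination_straddles[OF K]) (auto simp: sum_negf)
  then obtain j where j: "j \<in> K" "t < r j" by auto
  have "?f x = m * x + (?f t - m * t)" if x: "x \<in> {r i..r j}" for x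
  proof (cases "x \<in> {r i, r j}")
    case True
    thus ?thesis using line[OF i(1)] line[OF j(1)] by (auto simp: algebra_simps)
  next
    case False
    hence x': "r i < x" "x < r j" using x by auto
    \<comment> \<open>Between the two points convexity bounds \<open>?f\<close> above by the chord,
      which lies on the supporting line, and the line itself bounds it below.\<close>
    define l where "l = (r j - x) / (r j - r i)"
    have l: "0 < l" "l < 1" using x' by (auto simp: l_def field_simps)
    have lx: "l * r i + (1 - l) * r j = x"
    proof -
      have "l * (r j - r i) = r j - x" using x' by (simp add: l_def)
      thus ?thesis by (simp add: algebra_simps)
    qed
    have "?f x \<le> l * ?f (r i) + (1 - l) * ?f (r j)"
      using f_q_convex[OF G r(2)[OF i(1)] r(2)[OF j(1)] l] lx by simp
    also have "\<dots> = ?f t + m * ((l * r i + (1 - l) * r j) - t)"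
      unfolding line[OF i(1)] line[OF j(1)] by (simp add: algebra_simps)
    finally have "?f x \<le> ?f t + m * (x - t)" unfolding lx .
    moreover have "x \<in> {0..1}" using r(2)[OF i(1)] r(2)[OF j(1)] x by auto
    ultimately show ?thesis using m[of x] by (simp add: algebra_simps)
  qed
  hence "\<exists>a b. \<forall>x\<in>{r i..r j}. ?f x = a * x + b" by blast
  moreover have "{r i..r j} \<subseteq> {0..1}" using r(2)[OF i(1)] r(2)[OF j(1)] by auto
  ultimately show ?thesis using i j r(1)
    by (intro exI[of _ "r i"] exI[of _ "r j"]) auto
qed

end
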